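(* Let $Q=(-10,10)^n\times(0,10]$, $J_1=(-1,1)^n\times(0,\tfrac12]$ and $J_3=(-\tfrac12,\tfrac12)^n\times(\tfrac14,\tfrac12]$. Let $q>n+2$, $p_1<p\le q$, $f\in L^p_+(Q)$ and $\mu\in L^q_+(Q)$. Assume that $\|f\|_{L^p(Q)}\le\varepsilon_1$, where $\varepsilon_1>0$ is the constant described in the context. Suppose that $v\in C(Q)$ is an $L^p$-viscosity subsolution of $$v_t+\mathcal P^-(D^2v)-\mu|Dv|-f=0\quad\text{in }Q$$ satisfying $$|\{(x,t)\in J_1: v(x,t)\ge s\}|\le A_0s^{-\beta_0}\quad\text{for all }s\ge1,$$ where $\beta_0>0$ and $A_0>1$. Then there exist $\nu=\nu(n,\Lambda,\lambda,p,q,\beta_0,A_0)>1$, $n_0=n_0(n,\Lambda,\lambda,p,q,\beta_0,A_0)\in\mathbb N$ and $\ell_j=\ell_j(n,\Lambda,\lambda,p,q,\beta_0,A_0)\in(0,1)$ for $j\in\mathbb N$ such that $\sum_{j=1}^\infty\ell_j<\infty$, and if $v(x_0,t_0)\ge\nu^{j-1}$ for some $j\ge n_0$ and $(x_0,t_0)\in\overline{J_3}$, then $$\sup_{\hat Q_j}v\ge\nu^j,\qquad\text{where }\hat Q_j=(x_0,t_0)+(-\ell_j,\ell_j)^n\times\left(-\tfrac{\ell_j^2}{10},0\right].$$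
   Context: Fix $n\in\mathbb N$ and constants $0<\lambda\le\Lambda<\infty$. $\mathbb S^n$ is the set of real symmetric $n\times n$ matrices with the usual order. The Pucci operators are $\mathcal P^+(X)=\max\{-\mathrm{Tr}(AX): A\in\mathbb S^n,\ \lambda I\le A\le\Lambda I\}$ and $\mathcal P^-(X)=\min\{-\mathrm{Tr}(AX): A\in\mathbb S^n,\ \lambda I\le A\le\Lambda I\}$ for $X\in\mathbb S^n$. $Du$, $D^2u$ are the first and second derivatives in the space variable $x$, and $u_t$ is the time derivative. $L^p_+(Q)$ is the set of nonnegative functions in $L^p(Q)$. For $Q=\Omega\times(0,T]$ the parabolic boundary is $\partial_pQ=(\Omega\times\{0\})\cup(\partial\Omega\times[0,T))$. The parabolic distance is $d((x,t),(y,s))=\sqrt{|x-y|^2+|t-s|}$, and $Q'\Subset Q$ means that the parabolic distance from $Q'$ to $\partial_pQ$ is positive. $W^{2,1}_p(Q)$ is the set of $f\in L^p(Q)$ with weak derivatives $f_t,f_{x_k},f_{x_kx_\ell}\in L^p(Q)$, with norm the sum of the $L^p$ norms of $f$ and of these derivatives; $W^{2,1}_{p,\mathrm{loc}}(Q)$ consists of functions in $W^{2,1}_p(Q')$ for all $Q'\Subset Q$. Set $Q_r(x,t)=(x,t)+(-r,r)^n\times(-r^2,0]$. $L^p$-viscosity sub/supersolutions: $u\in C(Q)$ is an $L^p$-viscosity subsolution (resp. supersolution) of $u_t+F(x,t,Du,D^2u)=0$ in $Q$ if for every $\phi\in W^{2,1}_{p,\mathrm{loc}}(Q)$ and every $(x,t)\in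 Q$ such that $u-\phi$ attains a maximum (resp. minimum) at $(x,t)$ over some cylinder $Q_r(x,t)\subset Q$, one has $\lim_{\varepsilon\to0}\operatorname{ess\,inf}_{(y,s)\in Q_\varepsilon(x,t)}\{\phi_t+F(y,s,D\phi,D^2\phi)\}\le0$ (resp. $\lim_{\varepsilon\to0}\operatorname{ess\,sup}_{(y,s)\in Q_\varepsilon(x,t)}\{\phi_t+F(y,s,D\phi,D^2\phi)\}\ge0$). $p_1=p_1(n,\Lambda/\lambda)\in[\frac{n+2}2,n+1)$ is the constant giving the range $p>p_1$ of exponents for which the Aleksandrov-Bakelman-Pucci maximum principle holds, i.e. for every $p>p_1$ there is $C=C(n,\Lambda,\lambda,p)$ such that, with $Q^*=\{|x|<1\}\times(0,1]$, for every $f\in L^p(Q^* )$ there is $u\in C(\overline{Q^*})\cap W^{2,1}_{p,\mathrm{loc}}(Q^* )$ with $u_t+\mathcal P^+(D^2u)=f$ a.e. in $Q^*$, $u=0$ on $\partial_pQ^*$, $-C\|f^-\|_{L^p(Q^* )}\le u\le C\|f^+\|_{L^p(Q^* )}$, and $\|u\|_{W^{2,1}_p(Q')}\le C'\|f\|_{L^p(Q^* )}$ for every $Q'\Subset Q^*$, where $C'$ depends only on $n,\Lambda,\lambda,p$ and the distance of $Q'$ to $\partial_pQ^*$. The constant $\varepsilon_1$ is the one fixed in the proof of the weak Harnack inequality: with $J_2=(-1,1)^n\times(9,10]$, there exist constants $A_*,\beta_*,\varepsilon_1>0$, depending only on $n,\Lambda,\lambda,p,q,\|\mu\|_{L^q(Q)}$,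 such that for all $\hat\mu\in L^q_+(Q)$ with $\|\hat\mu\|_{L^q(Q)}\le\|\mu\|_{L^q(Q)}$ and all $\hat f\in L^p_+(Q)$ with $\|\hat f\|_{L^p(Q)}\le\varepsilon_1$, every nonnegative $L^p$-viscosity supersolution $w\in C(Q)$ of $w_t+\mathcal P^+(D^2w)+\hat\mu|Dw|+\hat f=0$ in $Q$ with $\inf_{J_2}w\le1$ satisfies $|\{(x,t)\in J_1: w(x,t)\ge s\}|\le A_*s^{-\beta_*}$ for all $s>0$. The source remarks that the constants $A_0,\beta_0$ of the lemma will be these constants $A_*,\beta_*$.
   Formalization: ν, n_0 and ℓ_j may also depend on the weak Harnack constants A_*, β_* (hence on ‖μ‖_q through them); for A_0, β_0 unrelated to A_*, β_* the stated dependence list is false, and with A_0=A_*, β_0=β_* it is recovered exactly. *)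

theory Defs
  imports "HOL-Analysis.Analysis" "HOL-Probability.Essential_Supremum"
begin

text \<open>The order on symmetric matrices is the one of quadratic forms; the type class order
  on \<open>real ^ 'n ^ 'n\<close> is componentwise and is not used.\<close>

definition mat_le :: "real ^ 'n ^ 'n \<Rightarrow> real ^ 'n ^ 'n \<Rightarrow> bool" where
  "mat_le A B \<longleftrightarrow> (\<forall>\<xi>. \<xi> \<bullet> (A *v \<xi>) \<le> \<xi> \<bullet> (B *v \<xi>))"

definition elliptic_matrices :: "real \<Rightarrow> real \<Rightarrow> (real ^ 'n ^ 'n) set" where
  "elliptic_matrices lam Lam =
     {A. transpose A = A \<and> mat_le (mat lam) A \<and> mat_le A (mat Lam)}"

text \<open>The set of admissible \<open>A\<close> is compact (and nonempty for \<open>lam \<le> Lam\<close>), so the supremum and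
  infimum are the maximum and minimum.\<close>

definition pucci_plus :: "real \<Rightarrow> real \<Rightarrow> real ^ 'n ^ 'n \<Rightarrow> real" where
  "pucci_plus lam Lam X = (SUP A \<in> elliptic_matrices lam Lam. - trace (A ** X))"

definition pucci_minus :: "real \<Rightarrow> real \<Rightarrow> real ^ 'n ^ 'n \<Rightarrow> real" where
  "pucci_minus lam Lam X = (INF A \<in> elliptic_matrices lam Lam. - trace (A ** X))"

definition Lp :: "real \<Rightarrow> 'a::euclidean_space set \<Rightarrow> ('a \<Rightarrow> real) set" where
  "Lp p Q = {g. g \<in> borel_measurable (lebesgue_on Q) \<and>
                integrable (lebesgue_on Q) (\<lambda>z. \<bar>g z\<bar> powr p)}"

definition Lp_norm :: "real \<Rightarrow> 'a::euclidean_space set \<Rightarrow> ('a \<Rightarrow> real) \<Rightarrow> real" where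
  "Lp_norm p Q g = (\<integral>z. \<bar>g z\<bar> powr p \<partial>lebesgue_on Q) powr (1 / p)"

definition Lp_nonneg :: "real \<Rightarrow> 'a::euclidean_space set \<Rightarrow> ('a \<Rightarrow> real) set" where
  "Lp_nonneg p Q = {g \<in> Lp p Q. AE z in lebesgue_on Q. 0 \<le> g z}"

primrec times_cont_diff :: "nat \<Rightarrow> ('a::euclidean_space \<Rightarrow> real) \<Rightarrow> bool" where
  "times_cont_diff 0 f \<longleftrightarrow> continuous_on UNIV f"
| "times_cont_diff (Suc k) f \<longleftrightarrow>
     (\<forall>x. f differentiable (at x)) \<and>
     (\<forall>b\<in>Basis. times_cont_diff k (\<lambda>x. frechet_derivative f (at x) b))"

definition test_function :: "'a::euclidean_space set \<Rightarrow> ('a \<Rightarrow> real) \<Rightarrow> bool" where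
  "test_function U \<eta> \<longleftrightarrow>
     (\<forall>k. times_cont_diff k \<eta>) \<and> (\<exists>K. compact K \<and> K \<subseteq> U \<and> (\<forall>z. z \<notin> K \<longrightarrow> \<eta> z = 0))"

text \<open>\<open>weak_deriv U b g h\<close>: on the open set \<open>U\<close>, \<open>h\<close> is the weak derivative of \<open>g\<close> in the
  direction \<open>b\<close>.\<close>

definition weak_deriv ::
    "'a::euclidean_space set \<Rightarrow> 'a \<Rightarrow> ('a \<Rightarrow> real) \<Rightarrow> ('a \<Rightarrow> real) \<Rightarrow> bool" where
  "weak_deriv U b g h \<longleftrightarrow>
     (\<forall>K. compact K \<and> K \<subseteq> U \<longrightarrow> g absolutely_integrable_on K \<and> h absolutely_integrable_on K) \<and>
     (\<forall>\<eta>. test_function U \<eta> \<longrightarrow>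
        (\<integral>z. g z * frechet_derivative \<eta> (at z) b \<partial>lebesgue_on U) =
        - (\<integral>z. h z * \<eta> z \<partial>lebesgue_on U))"

text \<open>Membership of \<open>u\<close> in \<open>W\<^sup>2\<^sup>,\<^sup>1\<^sub>p(Q)\<close> is expressed together with (representatives of) its weak
  derivatives \<open>ut\<close>, \<open>Du\<close>, \<open>D2u\<close>. Since \<open>Q\<close> need not be open (parabolic cylinders contain their top),
  weak derivatives are taken in its interior; this is only used for \<open>Q\<close> that agree with their
  interior up to a null set.\<close>

definition W21_with ::
    "real \<Rightarrow> ((real ^ 'n) \<times> real) set \<Rightarrow> ((real ^ 'n) \<times> real \<Rightarrow> real) \<Rightarrow>
     ((real ^ 'n) \<times> real \<Rightarrow> real) \<Rightarrow> ((real ^ 'n) \<times> real \<Rightarrow> real ^ 'n) \<Rightarrow>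
     ((real ^ 'n) \<times> real \<Rightarrow> real ^ 'n ^ 'n) \<Rightarrow> bool" where
  "W21_with p Q u ut Du D2u \<longleftrightarrow>
     u \<in> Lp p Q \<and> ut \<in> Lp p Q \<and>
     (\<forall>k. (\<lambda>z. Du z $ k) \<in> Lp p Q) \<and>
     (\<forall>k l. (\<lambda>z. D2u z $ k $ l) \<in> Lp p Q) \<and>
     weak_deriv (interior Q) (0, 1) u ut \<and>
     (\<forall>k. weak_deriv (interior Q) (axis k 1, 0) u (\<lambda>z. Du z $ k)) \<and>
     (\<forall>k l. weak_deriv (interior Q) (axis l 1, 0) (\<lambda>z. Du z $ k) (\<lambda>z. D2u z $ k $ l))"

definition W21_norm ::
    "real \<Rightarrow> ((real ^ 'n) \<times> real) set \<Rightarrow> ((real ^ 'n) \<times> real \<Rightarrow> real) \<Rightarrow>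
     ((real ^ 'n) \<times> real \<Rightarrow> real) \<Rightarrow> ((real ^ 'n) \<times> real \<Rightarrow> real ^ 'n) \<Rightarrow>
     ((real ^ 'n) \<times> real \<Rightarrow> real ^ 'n ^ 'n) \<Rightarrow> real" where
  "W21_norm p Q u ut Du D2u =
     Lp_norm p Q u + Lp_norm p Q ut +
     (\<Sum>k\<in>UNIV. Lp_norm p Q (\<lambda>z. Du z $ k)) +
     (\<Sum>k\<in>UNIV. \<Sum>l\<in>UNIV. Lp_norm p Q (\<lambda>z. D2u z $ k $ l))"

definition pcylinder :: "(real ^ 'n) set \<Rightarrow> real \<Rightarrow> ((real ^ 'n) \<times> real) set" where
  "pcylinder \<Omega> T = \<Omega> \<times> {0<..T}"

definition pboundary :: "(real ^ 'n) set \<Rightarrow> real \<Rightarrow> ((real ^ 'n) \<times> real) set" where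
  "pboundary \<Omega> T = \<Omega> \<times> {0} \<union> frontier \<Omega> \<times> {0..<T}"

definition pdist :: "(real ^ 'n) \<times> real \<Rightarrow> (real ^ 'n) \<times> real \<Rightarrow> real" where
  "pdist z w = sqrt ((norm (fst z - fst w))\<^sup>2 + \<bar>snd z - snd w\<bar>)"

definition pset_dist :: "((real ^ 'n) \<times> real) set \<Rightarrow> ((real ^ 'n) \<times> real) set \<Rightarrow> ereal" where
  "pset_dist S S' = (INF z\<in>S. INF w\<in>S'. ereal (pdist z w))"

text \<open>\<open>pcompactly_in Q' \<Omega> T\<close>: the set \<open>Q'\<close> lies compactly, in the parabolic sense, in
  \<open>\<Omega> \<times> (0,T]\<close>. The negligibility condition admits open sets and cylinders containing their top, and
  excludes only sets on which weak derivatives make no sense.\<close>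

definition pcompactly_in :: "((real ^ 'n) \<times> real) set \<Rightarrow> (real ^ 'n) set \<Rightarrow> real \<Rightarrow> bool" where
  "pcompactly_in Q' \<Omega> T \<longleftrightarrow>
     Q' \<subseteq> pcylinder \<Omega> T \<and> negligible (Q' - interior Q') \<and>
     0 < pset_dist Q' (pboundary \<Omega> T)"

definition W21_loc_with ::
    "real \<Rightarrow> (real ^ 'n) set \<Rightarrow> real \<Rightarrow> ((real ^ 'n) \<times> real \<Rightarrow> real) \<Rightarrow>
     ((real ^ 'n) \<times> real \<Rightarrow> real) \<Rightarrow> ((real ^ 'n) \<times> real \<Rightarrow> real ^ 'n) \<Rightarrow>
     ((real ^ 'n) \<times> real \<Rightarrow> real ^ 'n ^ 'n) \<Rightarrow> bool" where
  "W21_loc_with p \<Omega> T u ut Du D2u \<longleftrightarrow>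
     (\<forall>Q'. pcompactly_in Q' \<Omega> T \<longrightarrow> W21_with p Q' u ut Du D2u)"

definition cube :: "real \<Rightarrow> (real ^ 'n) set" where
  "cube r = {x. \<forall>i. - r < x $ i \<and> x $ i < r}"

definition Qr :: "real \<Rightarrow> (real ^ 'n) \<times> real \<Rightarrow> ((real ^ 'n) \<times> real) set" where
  "Qr r z = {(fst z + y, snd z + s) | y s. y \<in> cube r \<and> s \<in> {- r\<^sup>2<..0}}"

definition ess_sup_on :: "((real ^ 'n) \<times> real) set \<Rightarrow> ((real ^ 'n) \<times> real \<Rightarrow> real) \<Rightarrow> ereal" where
  "ess_sup_on S g = esssup (lebesgue_on S) (\<lambda>z. ereal (g z))"

definition ess_inf_on :: "((real ^ 'n) \<times> real) set \<Rightarrow> ((real ^ 'n) \<times> real \<Rightarrow> real) \<Rightarrow> ereal" where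
  "ess_inf_on S g = - esssup (lebesgue_on S) (\<lambda>z. - ereal (g z))"

text \<open>Elements of \<open>W\<^sup>2\<^sup>,\<^sup>1\<^sub>p\<^sub>,\<^sub>l\<^sub>o\<^sub>c\<close> are continuous for \<open>p > (n+2)/2\<close> after modification on a null set.
  Test functions are touched pointwise, so they are taken to be the continuous representative.
  The nonlinearity has arguments \<open>F z \<xi> X\<close> with \<open>z = (x,t)\<close>.\<close>

definition Lp_visc_subsol ::
    "real \<Rightarrow> ((real ^ 'n) \<times> real \<Rightarrow> real ^ 'n \<Rightarrow> real ^ 'n ^ 'n \<Rightarrow> real) \<Rightarrow>
     (real ^ 'n) set \<Rightarrow> real \<Rightarrow> ((real ^ 'n) \<times> real \<Rightarrow> real) \<Rightarrow> bool" where
  "Lp_visc_subsol p F \<Omega> T u \<longleftrightarrow>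
     continuous_on (pcylinder \<Omega> T) u \<and>
     (\<forall>\<phi> \<phi>t D\<phi> D2\<phi>. continuous_on (pcylinder \<Omega> T) \<phi> \<longrightarrow> W21_loc_with p \<Omega> T \<phi> \<phi>t D\<phi> D2\<phi> \<longrightarrow>
       (\<forall>z \<in> pcylinder \<Omega> T.
          (\<exists>r>0. Qr r z \<subseteq> pcylinder \<Omega> T \<and> (\<forall>w \<in> Qr r z. u w - \<phi> w \<le> u z - \<phi> z)) \<longrightarrow>
          (\<exists>l::ereal. ((\<lambda>\<epsilon>. ess_inf_on (Qr \<epsilon> z) (\<lambda>w. \<phi>t w + F w (D\<phi> w) (D2\<phi> w))) \<longlongrightarrow> l)
                        (at_right 0) \<and> l \<le> 0)))"

definition Lp_visc_supersol ::
    "real \<Rightarrow> ((real ^ 'n) \<times> real \<Rightarrow> real ^ 'n \<Rightarrow> real ^ 'n ^ 'n \<Rightarrow> real) \<Rightarrow>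
     (real ^ 'n) set \<Rightarrow> real \<Rightarrow> ((real ^ 'n) \<times> real \<Rightarrow> real) \<Rightarrow> bool" where
  "Lp_visc_supersol p F \<Omega> T u \<longleftrightarrow>
     continuous_on (pcylinder \<Omega> T) u \<and>
     (\<forall>\<phi> \<phi>t D\<phi> D2\<phi>. continuous_on (pcylinder \<Omega> T) \<phi> \<longrightarrow> W21_loc_with p \<Omega> T \<phi> \<phi>t D\<phi> D2\<phi> \<longrightarrow>
       (\<forall>z \<in> pcylinder \<Omega> T.
          (\<exists>r>0. Qr r z \<subseteq> pcylinder \<Omega> T \<and> (\<forall>w \<in> Qr r z. u z - \<phi> z \<le> u w - \<phi> w)) \<longrightarrow>
          (\<exists>l::ereal. ((\<lambda>\<epsilon>. ess_sup_on (Qr \<epsilon> z) (\<lambda>w. \<phi>t w + F w (D\<phi> w) (D2\<phi> w))) \<longlongrightarrow> l)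
                        (at_right 0) \<and> l \<ge> 0)))"

text \<open>\<open>ABP_exponent TYPE('n) lam Lam p1\<close>: the Aleksandrov-Bakelman-Pucci maximum principle for
  \<open>u\<^sub>t + P\<^sup>+(D\<^sup>2u) = f\<close> in dimension \<open>CARD('n)\<close> holds in the range \<open>p > p1\<close>. The constant \<open>C'\<close> of the
  interior estimate is a function of the parabolic distance of \<open>Q'\<close> to the parabolic boundary.\<close>

definition ABP_exponent :: "'n::finite itself \<Rightarrow> real \<Rightarrow> real \<Rightarrow> real \<Rightarrow> bool" where
  "ABP_exponent (_ :: 'n itself) lam Lam p1 \<longleftrightarrow>
     (real CARD('n) + 2) / 2 \<le> p1 \<and> p1 < real CARD('n) + 1 \<and>
     (\<forall>p>p1. \<exists>(C::real) (C' :: ereal \<Rightarrow> real).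
        let B = ball (0 :: real ^ 'n) 1; Qs = pcylinder B 1 in
        \<forall>f \<in> Lp p Qs. \<exists>u ut Du D2u.
          continuous_on (closure Qs) u \<and> W21_loc_with p B 1 u ut Du D2u \<and>
          (AE z in lebesgue_on Qs. ut z + pucci_plus lam Lam (D2u z) = f z) \<and>
          (\<forall>z \<in> pboundary B 1. u z = 0) \<and>
          (\<forall>z \<in> Qs. - C * Lp_norm p Qs (\<lambda>w. max (- f w) 0) \<le> u z \<and>
                    u z \<le> C * Lp_norm p Qs (\<lambda>w. max (f w) 0)) \<and>
          (\<forall>Q'. pcompactly_in Q' B 1 \<longrightarrow>
             W21_norm p Q' u ut Du D2u \<le> C' (pset_dist Q' (pboundary B 1)) * Lp_norm p Qs f))"

abbreviation Q10 :: "((real ^ 'n) \<times> real) set" where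
  "Q10 \<equiv> pcylinder (cube 10) 10"

definition J1 :: "((real ^ 'n) \<times> real) set" where
  "J1 = cube 1 \<times> {0<..1/2}"

definition J2 :: "((real ^ 'n) \<times> real) set" where
  "J2 = cube 1 \<times> {9<..10}"

definition J3 :: "((real ^ 'n) \<times> real) set" where
  "J3 = cube (1/2) \<times> {1/4<..1/2}"

text \<open>\<open>(A, \<beta>, \<epsilon>1)\<close> are admissible constants in the measure estimate behind the weak Harnack
  inequality, for drift terms of \<open>L\<^sup>q\<close> norm at most \<open>M\<close>. The infimum over \<open>J2\<close> is bounded below by 0.\<close>

definition weak_Harnack_constants ::
    "'n::finite itself \<Rightarrow> real \<Rightarrow> real \<Rightarrow> real \<Rightarrow> real \<Rightarrow> real \<Rightarrow> real \<Rightarrow> real \<Rightarrow> real \<Rightarrow> bool" where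
  "weak_Harnack_constants (_ :: 'n itself) lam Lam p q M A \<beta> \<epsilon>1 \<longleftrightarrow>
     A > 0 \<and> \<beta> > 0 \<and> \<epsilon>1 > 0 \<and>
     (\<forall>(\<mu> :: (real ^ 'n) \<times> real \<Rightarrow> real) f w.
        \<mu> \<in> Lp_nonneg q Q10 \<longrightarrow> Lp_norm q Q10 \<mu> \<le> M \<longrightarrow>
        f \<in> Lp_nonneg p Q10 \<longrightarrow> Lp_norm p Q10 f \<le> \<epsilon>1 \<longrightarrow>
        Lp_visc_supersol p (\<lambda>z \<xi> X. pucci_plus lam Lam X + \<mu> z * norm \<xi> + f z) (cube 10) 10 w \<longrightarrow>
        (\<forall>z \<in> Q10. 0 \<le> w z) \<longrightarrow> (INF z\<in>J2. w z) \<le> 1 \<longrightarrow>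
        (\<forall>s>0. measure lebesgue {z \<in> J1. w z \<ge> s} \<le> A * s powr (- \<beta>)))"

definition Qhat :: "real \<Rightarrow> (real ^ 'n) \<times> real \<Rightarrow> ((real ^ 'n) \<times> real) set" where
  "Qhat l z = {(fst z + y, snd z + s) | y s. y \<in> cube l \<and> s \<in> {- (l\<^sup>2 / 10)<..0}}"

end

theory Submission
  imports Defs
begin

text \<open>If \<open>v < \<nu>\<^sup>j\<close> on the small cylinder at \<open>(x\<^sub>0,t\<^sub>0)\<close>, then \<open>w = (\<nu>\<^sup>j - v) / c\<close> with
  \<open>c = \<nu>\<^sup>j\<^sup>-\<^sup>1 (\<nu> - 1)\<close>, parabolically rescaled to \<open>Q\<close>, is a nonnegative supersolution which is at most 1
  at a point of \<open>J\<^sub>2\<close>; the rescaling does not increase the norms of the data. The weak Harnack estimate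
  bounds the measure of \<open>{w \<ge> s\<^sub>0}\<close> and the decay hypothesis that of \<open>{v \<ge> \<nu>\<^sup>j / 2}\<close>. For \<open>\<nu>\<close> close
  to 1 and radii \<open>r\<close> with \<open>r\<^sup>n\<^sup>+\<^sup>2\<close> a large multiple of \<open>\<nu>\<close> to the power \<open>- j \<beta>\<^sub>0\<close>, the two sets are too
  small to cover \<open>J\<^sub>1\<close>.

  Transferring the viscosity inequality to \<open>w\<close> requires a test function for \<open>v\<close> on all of \<open>Q\<close>, while
  the rescaled one lives on the small cylinder only. It is extended by even reflection across the
  top of the cylinder, followed by multiplication with a smooth cutoff.\<close>

section \<open>Smooth functions\<close>

lemma times_cont_diff_SucD: "times_cont_diff (Suc k) f \<Longrightarrow> times_cont_diff k f"
proof (induction k arbitrary: f)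
  case 0
  then show ?case
    by (simp add: differentiable_imp_continuous_on differentiable_on_def)
next
  case (Suc k)
  have "times_cont_diff k (\<lambda>x. frechet_derivative f (at x) b)" if "b \<in> Basis" for b
    using Suc.prems that by (intro Suc.IH) (subst (asm) times_cont_diff.simps(2), blast)
  with Suc.prems show ?case
    by (subst times_cont_diff.simps(2), subst (asm) times_cont_diff.simps(2)) blast
qed

lemma times_cont_diff_const: "times_cont_diff k (\<lambda>x. c)"
  by (induction k arbitrary: c) auto

lemma times_cont_diff_linear:
  assumes "bounded_linear f"
  shows "times_cont_diff k f"
proof (cases k)
  case 0
  then show ?thesis
    using assms by (simp add: linear_continuous_on)
next
  case (Suc m)
  have d: "(f has_derivative f) (at x)" for x
    using assms by (rule bounded_linear_imp_has_derivative)
  then have "frechet_derivative f (at x) = f" for x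
    by (metis frechet_derivative_at)
  with d Suc show ?thesis
    by (auto simp: times_cont_diff_const differentiable_def)
qed

lemma has_derivative_frechet:
  "f differentiable (at x) \<Longrightarrow> (f has_derivative frechet_derivative f (at x)) (at x)"
  by (simp add: frechet_derivative_works)

lemma frechet_derivative_eqI:
  "(f has_derivative f') (at x) \<Longrightarrow> frechet_derivative f (at x) = f'"
  by (metis frechet_derivative_at)

lemma times_cont_diff_add:
  assumes "times_cont_diff k f" "times_cont_diff k g"
  shows "times_cont_diff k (\<lambda>x. f x + g x)"
  using assms
proof (induction k arbitrary: f g)
  case 0
  then show ?case by (auto intro: continuous_intros)
next
  case (Suc k)
  have "frechet_derivative (\<lambda>x. f x + g x) (at x) =
      (\<lambda>b. frechet_derivative f (at x) b + frechet_derivative g (at x) b)" for x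
    using Suc.prems by (intro frechet_derivative_eqI has_derivative_add has_derivative_frechet) auto
  with Suc show ?case by auto
qed

lemma frechet_derivative_mult:
  fixes f g :: "'a::real_normed_vector \<Rightarrow> real"
  assumes "f differentiable (at x)" "g differentiable (at x)"
  shows "frechet_derivative (\<lambda>x. f x * g x) (at x) =
    (\<lambda>b. f x * frechet_derivative g (at x) b + frechet_derivative f (at x) b * g x)"
  using assms by (intro frechet_derivative_eqI has_derivative_mult has_derivative_frechet)

lemma times_cont_diff_mult:
  assumes "times_cont_diff k f" "times_cont_diff k g"
  shows "times_cont_diff k (\<lambda>x. f x * g x)"
  using assms
proof (induction k arbitrary: f g)
  case 0
  then show ?case by (auto intro: continuous_intros)
next
  case (Suc k)
  have "frechet_derivative (\<lambda>x. f x * g x) (at x) =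
      (\<lambda>b. f x * frechet_derivative g (at x) b + frechet_derivative f (at x) b * g x)" for x
    using Suc.prems by (intro frechet_derivative_mult) auto
  moreover have "times_cont_diff k f" "times_cont_diff k g"
    using Suc.prems by (auto intro: times_cont_diff_SucD simp del: times_cont_diff.simps)
  ultimately show ?case
    using Suc by (auto intro!: times_cont_diff_add)
qed

lemma times_cont_diff_cmult: "times_cont_diff k f \<Longrightarrow> times_cont_diff k (\<lambda>x. c * f x)"
  by (intro times_cont_diff_mult times_cont_diff_const)

definition diag_affine :: "('a::euclidean_space \<Rightarrow> real) \<Rightarrow> 'a \<Rightarrow> 'a \<Rightarrow> 'a" where
  "diag_affine c a x = a + (\<Sum>j\<in>Basis. (c j * (x \<bullet> j)) *\<^sub>R j)"

lemma has_derivative_diag_affine: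
  "(diag_affine c a has_derivative diag_affine c 0) (at x)"
  unfolding diag_affine_def[abs_def] by (auto intro!: derivative_eq_intros simp: algebra_simps)

lemma diag_affine_Basis: "b \<in> Basis \<Longrightarrow> diag_affine c 0 b = c b *\<^sub>R b"
  by (simp add: diag_affine_def inner_Basis if_distrib if_distribR sum.delta cong: if_cong)

lemma frechet_derivative_diag_affine:
  assumes "f differentiable (at (diag_affine c a x))" "b \<in> Basis"
  shows "frechet_derivative (\<lambda>x. f (diag_affine c a x)) (at x) b =
    c b * frechet_derivative f (at (diag_affine c a x)) b"
proof -
  have "frechet_derivative (f \<circ> diag_affine c a) (at x) =
      frechet_derivative f (at (diag_affine c a x)) \<circ> diag_affine c 0"
    using has_derivative_frechet[OF assms(1)]
    by (intro frechet_derivative_eqI diff_chain_at has_derivative_diag_affine)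
  moreover have "linear (frechet_derivative f (at (diag_affine c a x)))"
    using assms(1) by (rule linear_frechet_derivative)
  ultimately show ?thesis
    using assms(2) by (simp add: o_def diag_affine_Basis linear_cmul)
qed

lemma times_cont_diff_diag_affine:
  "times_cont_diff k f \<Longrightarrow> times_cont_diff k (\<lambda>x. f (diag_affine c a x))"
proof (induction k arbitrary: f)
  case 0
  then show ?case
    by (auto simp: diag_affine_def intro!: continuous_intros continuous_on_compose2[of UNIV f])
next
  case (Suc k)
  have "(\<lambda>x. f (diag_affine c a x)) differentiable (at x)" for x
    using differentiable_chain_at[of "diag_affine c a" x f] Suc.prems
      has_derivative_diag_affine[of c a x]
    by (auto simp: o_def intro: differentiableI)
  moreover have "frechet_derivative (\<lambda>x. f (diag_affine c a x)) (at x) b =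
    c b * frechet_derivative f (at (diag_affine c a x)) b" if "b \<in> Basis" for x b
    using Suc.prems that by (intro frechet_derivative_diag_affine) auto
  moreover have "times_cont_diff k (\<lambda>x. c b * frechet_derivative f (at (diag_affine c a x)) b)"
    if "b \<in> Basis" for b
    using Suc.prems that Suc.IH[of "\<lambda>y. frechet_derivative f (at y) b"]
    by (auto intro!: times_cont_diff_cmult)
  ultimately show ?case
    by auto
qed

text \<open>The family \<open>x\<^sup>-\<^sup>k exp (-1/x)\<close>, extended by 0 to \<open>x \<le> 0\<close>, is closed under differentiation up
  to linear combinations, which makes smoothness an induction over all members at once.\<close>

definition flat :: "nat \<Rightarrow> real \<Rightarrow> real" where
  "flat k x = (if 0 < x then (1 / x) ^ k * exp (- (1 / x)) else 0)"

lemma flat_tendsto_0: "(flat k \<longlongrightarrow> 0) (at_right 0)"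
proof -
  have "((\<lambda>x. inverse x ^ k / exp (inverse x)) \<longlongrightarrow> 0) (at_right (0::real))"
    by (rule filterlim_compose[OF tendsto_power_div_exp_0 filterlim_inverse_at_top_right])
  moreover have "eventually (\<lambda>x. inverse x ^ k / exp (inverse x) = flat k x) (at_right 0)"
    by (auto simp: eventually_at_right_field flat_def exp_minus divide_simps intro!: exI[of _ 1])
  ultimately show ?thesis
    by (rule Lim_transform_eventually)
qed

lemma DERIV_flat:
  "(flat k has_real_derivative flat (k + 2) x - real k * flat (k + 1) x) (at x)"
proof -
  consider "x > 0" | "x < 0" | "x = 0" by linarith
  then show ?thesis
  proof cases
    case 1
    have "((\<lambda>x. (1 / x) ^ k * exp (- (1 / x))) has_real_derivative
        flat (k + 2) x - real k * flat (k + 1) x) (at x)"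
    proof (rule DERIV_cong)
      show "((\<lambda>x. (1 / x) ^ k * exp (- (1 / x))) has_real_derivative
        real k * (1 / x) ^ (k - 1) * (- 1 / x\<^sup>2) * exp (- (1 / x)) +
        (1 / x) ^ k * (exp (- (1 / x)) * (1 / x\<^sup>2))) (at x)"
        using 1 by (auto intro!: derivative_eq_intros simp: power2_eq_square)
      show "real k * (1 / x) ^ (k - 1) * (- 1 / x\<^sup>2) * exp (- (1 / x)) +
        (1 / x) ^ k * (exp (- (1 / x)) * (1 / x\<^sup>2)) = flat (k + 2) x - real k * flat (k + 1) x"
        using 1 by (cases k) (auto simp: flat_def field_simps power2_eq_square)
    qed
    then show ?thesis
      by (rule has_field_derivative_transform_within_open[of _ _ _ "{0<..}"])
        (use 1 in \<open>auto simp: flat_def\<close>)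
  next
    case 2
    have "((\<lambda>x. 0) has_real_derivative flat (k + 2) x - real k * flat (k + 1) x) (at x)"
      using 2 by (auto simp: flat_def)
    then show ?thesis
      by (rule has_field_derivative_transform_within_open[of _ _ _ "{..<0}"])
        (use 2 in \<open>auto simp: flat_def\<close>)
  next
    case 3
    have "((\<lambda>h. (flat k h - flat k 0) / (h - 0)) \<longlongrightarrow> 0) (at_right 0)"
      using flat_tendsto_0[of "k + 1"]
      by (rule Lim_transform_eventually)
        (auto simp: flat_def eventually_at_right_field intro!: exI[of _ 1])
    moreover have "((\<lambda>h. (flat k h - flat k 0) / (h - 0)) \<longlongrightarrow> 0) (at_left 0)"
      by (rule Lim_transform_eventually[OF tendsto_const])
        (auto simp: flat_def eventually_at_left_field intro!: exI[of _ "-1"])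
    ultimately have "((\<lambda>h. (flat k h - flat k 0) / (h - 0)) \<longlongrightarrow> 0) (at 0)"
      by (simp add: filterlim_split_at)
    then show ?thesis
      using 3 by (simp add: has_field_derivative_iff flat_def)
  qed
qed

lemma times_cont_diff_flat: "times_cont_diff m g \<Longrightarrow> times_cont_diff m (\<lambda>x. flat k (g x))"
proof (induction m arbitrary: k)
  case 0
  have "continuous_on UNIV (flat k)"
    using DERIV_flat by (meson DERIV_isCont continuous_at_imp_continuous_on)
  with 0 show ?case
    by (auto intro: continuous_on_compose2)
next
  case (Suc m)
  let ?D = "\<lambda>x. flat (k + 2) (g x) - real k * flat (k + 1) (g x)"
  have g: "times_cont_diff m g"
    using Suc.prems by (rule times_cont_diff_SucD)
  have d: "((\<lambda>x. flat k (g x)) has_derivative (\<lambda>b. ?D x * frechet_derivative g (at x) b)) (at x)"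
    for x
    using diff_chain_at[OF has_derivative_frechet DERIV_flat[THEN has_field_derivative_imp_has_derivative],
        of g x k] Suc.prems by (simp add: o_def)
  have "times_cont_diff m (\<lambda>x. ?D x * frechet_derivative g (at x) b)" if "b \<in> Basis" for b
    using times_cont_diff_cmult[OF Suc.IH[OF g, of "k + 1"], of "- real k"] Suc.prems that
    by (intro times_cont_diff_mult)
      (auto simp: diff_conv_add_uminus intro!: times_cont_diff_add Suc.IH g simp del: add_uminus_conv_diff)
  with d show ?case
    by (auto simp: frechet_derivative_eqI[OF d] differentiable_def simp del: add_2_eq_Suc')
qed

definition step :: "real \<Rightarrow> real" where
  "step x = exp 1 * flat 0 (1 - exp 1 * flat 0 x)"

lemma step_eq_1: "x \<le> 0 \<Longrightarrow> step x = 1"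
  by (simp add: step_def flat_def exp_minus)

lemma step_eq_0: "1 \<le> x \<Longrightarrow> step x = 0"
  by (auto simp: step_def flat_def exp_minus field_simps)

lemma times_cont_diff_step: "times_cont_diff k g \<Longrightarrow> times_cont_diff k (\<lambda>x. step (g x))"
  unfolding step_def diff_conv_add_uminus minus_mult_left
  by (intro times_cont_diff_cmult times_cont_diff_flat times_cont_diff_add times_cont_diff_const)

lemma step_bounds: "0 \<le> step x" "step x \<le> 1"
proof -
  show "0 \<le> step x" by (simp add: step_def flat_def)
  have "flat 0 y \<le> exp (-1)" if "y \<le> 1" for y
    using that by (auto simp: flat_def)
  moreover have "1 - exp 1 * flat 0 x \<le> 1" by (simp add: flat_def)
  ultimately have "flat 0 (1 - exp 1 * flat 0 x) \<le> exp (-1)" by blast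
  then show "step x \<le> 1"
    by (simp add: step_def exp_minus field_simps)
qed

section \<open>Test functions\<close>

lemma test_function_times_cont_diff: "test_function U \<eta> \<Longrightarrow> times_cont_diff k \<eta>"
  by (simp add: test_function_def)

lemma test_function_differentiable: "test_function U \<eta> \<Longrightarrow> \<eta> differentiable (at x)"
  using test_function_times_cont_diff[of U \<eta> 1] by simp

lemma test_function_continuous: "test_function U \<eta> \<Longrightarrow> continuous_on UNIV \<eta>"
  using test_function_times_cont_diff[of U \<eta> 0] by simp

lemma test_function_mono: "test_function U \<eta> \<Longrightarrow> U \<subseteq> V \<Longrightarrow> test_function V \<eta>"
  unfolding test_function_def by blast

lemma frechet_derivative_zero_off_support:
  assumes "closed K" "\<And>z. z \<notin> K \<Longrightarrow> \<eta> z = 0" "z \<notin> K"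
  shows "frechet_derivative \<eta> (at z) = (\<lambda>_. 0)"
proof -
  have "(\<eta> has_derivative (\<lambda>_. 0)) (at z)"
    by (rule has_derivative_transform_within_open[of "\<lambda>_. 0" _ _ _ "- K"])
      (use assms in auto)
  then show ?thesis by (rule frechet_derivative_eqI)
qed

lemma test_function_deriv:
  assumes "test_function U \<eta>" "b \<in> Basis"
  shows "test_function U (\<lambda>z. frechet_derivative \<eta> (at z) b)"
proof -
  obtain K where K: "compact K" "K \<subseteq> U" "\<And>z. z \<notin> K \<Longrightarrow> \<eta> z = 0"
    using assms(1) unfolding test_function_def by blast
  have "times_cont_diff k (\<lambda>z. frechet_derivative \<eta> (at z) b)" for k
    using test_function_times_cont_diff[OF assms(1), of "Suc k"] assms(2) by simp
  then show ?thesis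
    using K frechet_derivative_zero_off_support[OF compact_imp_closed[OF K(1)] K(3)]
    by (auto simp: test_function_def)
qed

lemma test_function_bounded:
  fixes \<eta> :: "'a::euclidean_space \<Rightarrow> real"
  assumes "test_function U \<eta>"
  obtains C where "0 \<le> C" "\<And>z. \<bar>\<eta> z\<bar> \<le> C"
proof -
  obtain K where K: "compact K" "K \<subseteq> U" "\<And>z. z \<notin> K \<Longrightarrow> \<eta> z = 0"
    using assms unfolding test_function_def by blast
  have "compact (\<eta> ` K)"
    using test_function_continuous[OF assms] K(1)
    by (intro compact_continuous_image) (auto intro: continuous_on_subset)
  then obtain C where C: "\<And>z. z \<in> K \<Longrightarrow> \<bar>\<eta> z\<bar> \<le> C"
    using compact_imp_bounded bounded_iff by (metis imageI real_norm_def)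
  have "\<bar>\<eta> z\<bar> \<le> max C 0" for z
    using C[of z] K(3)[of z] by (cases "z \<in> K") auto
  then show thesis using that[of "max C 0"] by auto
qed

lemma test_function_measurable: "test_function U \<eta> \<Longrightarrow> \<eta> \<in> borel_measurable lebesgue"
  by (rule measurable_completion)
    (simp add: borel_measurable_continuous_onI test_function_continuous)

lemma test_function_mult:
  assumes "test_function U \<theta>" "\<And>k. times_cont_diff k \<eta>"
  shows "test_function U (\<lambda>z. \<theta> z * \<eta> z)"
  using assms by (auto simp: test_function_def intro!: times_cont_diff_mult)

lemma test_function_cutoff:
  fixes z :: "'a::euclidean_space"
  assumes "open U" "z \<in> U"
  obtains \<theta> \<delta> where "test_function U \<theta>" "0 < \<delta>" "\<And>w. dist w z < \<delta> \<Longrightarrow> \<theta> w = 1"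
proof -
  obtain e where e: "0 < e" "cball z e \<subseteq> U"
    using assms open_contains_cball by blast
  define \<theta> where "\<theta> w = step (4 / e\<^sup>2 * ((w - z) \<bullet> (w - z)) - 1)" for w
  have "times_cont_diff k (\<lambda>w. \<Sum>b\<in>B. ((w - z) \<bullet> b) * ((w - z) \<bullet> b))" if "finite B" for k B
    using that
  proof (induction B rule: finite_induct)
    case empty
    then show ?case by (simp add: times_cont_diff_const)
  next
    case (insert b B)
    have "times_cont_diff k (\<lambda>w. (w - z) \<bullet> b)"
      using times_cont_diff_add[OF times_cont_diff_linear[OF bounded_linear_inner_left[of b]]
          times_cont_diff_const[of k "- (z \<bullet> b)"]]
      by (simp add: inner_diff_left)
    with insert show ?case
      by (auto intro!: times_cont_diff_add times_cont_diff_mult)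
  qed
  from this[OF finite_Basis] have "times_cont_diff k (\<lambda>w. (w - z) \<bullet> (w - z))" for k
    by (subst euclidean_inner)
  then have "times_cont_diff k \<theta>" for k
    unfolding \<theta>_def diff_conv_add_uminus
    by (intro times_cont_diff_step times_cont_diff_add times_cont_diff_cmult times_cont_diff_const)
  moreover have "\<theta> w = 0" if "w \<notin> cball z e" for w
    unfolding \<theta>_def
  proof (rule step_eq_0)
    have "e\<^sup>2 \<le> (norm (w - z))\<^sup>2"
      using that e by (intro power_mono) (auto simp: dist_norm norm_minus_commute)
    then have "e\<^sup>2 \<le> 2 * ((w - z) \<bullet> (w - z))"
      using inner_ge_zero[of "w - z"] unfolding power2_norm_eq_inner by linarith
    then show "1 \<le> 4 / e\<^sup>2 * ((w - z) \<bullet> (w - z)) - 1"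
      using e by (simp add: field_simps)
  qed
  ultimately have "test_function U \<theta>"
    using e by (auto simp: test_function_def intro!: exI[of _ "cball z e"])
  moreover have "\<theta> w = 1" if "dist w z < e / 2" for w
    unfolding \<theta>_def
  proof (rule step_eq_1)
    have "(norm (w - z))\<^sup>2 \<le> (e / 2)\<^sup>2"
      using that e by (intro power_mono) (auto simp: dist_norm)
    then show "4 / e\<^sup>2 * ((w - z) \<bullet> (w - z)) - 1 \<le> 0"
      using e by (simp add: power2_norm_eq_inner field_simps)
  qed
  ultimately show thesis using that[of \<theta> "e / 2"] e by simp
qed

section \<open>Diagonal affine changes of variables\<close>

lemma inner_diag_affine: "j \<in> Basis \<Longrightarrow> diag_affine c a x \<bullet> j = a \<bullet> j + c j * (x \<bullet> j)"
  by (simp add: diag_affine_def inner_add_left inner_sum_left inner_Basis if_distrib if_distribR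
      sum.delta cong: if_cong)

definition diag_affine_inv :: "('a::euclidean_space \<Rightarrow> real) \<Rightarrow> 'a \<Rightarrow> 'a \<Rightarrow> 'a" where
  "diag_affine_inv c a = diag_affine (\<lambda>j. 1 / c j) (- diag_affine (\<lambda>j. 1 / c j) 0 a)"

locale nonsingular_diag =
  fixes c :: "'a::euclidean_space \<Rightarrow> real" and a :: 'a
  assumes nz: "\<And>j. j \<in> Basis \<Longrightarrow> c j \<noteq> 0"
begin

abbreviation "T \<equiv> diag_affine c a"
abbreviation "Tinv \<equiv> diag_affine_inv c a"
definition "J = (\<Prod>j\<in>Basis. \<bar>c j\<bar>)"

lemma T_Tinv [simp]: "T (Tinv x) = x"
  by (rule euclidean_eqI) (simp add: diag_affine_inv_def inner_diag_affine nz field_simps)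

lemma Tinv_T [simp]: "Tinv (T x) = x"
  by (rule euclidean_eqI) (simp add: diag_affine_inv_def inner_diag_affine nz field_simps)

lemma bij_T: "bij T"
  by (rule o_bij[of Tinv]) (auto simp: fun_eq_iff)

lemma jacobian_pos: "0 < J"
  unfolding J_def by (rule prod_pos) (auto simp: nz)

lemma T_eq: "T = (\<lambda>x. a + (\<Sum>j\<in>Basis. (c j * (x \<bullet> j)) *\<^sub>R j))"
  by (simp add: diag_affine_def fun_eq_iff)

lemma T_measurable: "T \<in> lebesgue \<rightarrow>\<^sub>M lebesgue"
  unfolding T_eq by (rule lebesgue_affine_measurable) (rule nz)

lemma Tinv_measurable: "Tinv \<in> lebesgue \<rightarrow>\<^sub>M lebesgue"
  unfolding diag_affine_inv_def
  by (rule nonsingular_diag.T_measurable) (simp add: nonsingular_diag_def nz)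

lemma lebesgue_eq: "lebesgue = density (distr lebesgue lebesgue T) (\<lambda>_. ennreal J)"
  unfolding T_eq J_def by (rule lebesgue_affine_euclidean) (rule nz)

lemma measurable_comp: "f \<in> lebesgue \<rightarrow>\<^sub>M N \<Longrightarrow> (\<lambda>x. f (T x)) \<in> lebesgue \<rightarrow>\<^sub>M N"
  using measurable_compose[OF T_measurable] .

lemma measurable_comp_iff: "(\<lambda>x. f (T x)) \<in> lebesgue \<rightarrow>\<^sub>M N \<longleftrightarrow> f \<in> lebesgue \<rightarrow>\<^sub>M N"
proof
  assume "(\<lambda>x. f (T x)) \<in> lebesgue \<rightarrow>\<^sub>M N"
  from measurable_compose[OF Tinv_measurable this] show "f \<in> lebesgue \<rightarrow>\<^sub>M N"
    by simp
qed (rule measurable_comp)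

lemma nn_integral_comp:
  assumes [measurable]: "f \<in> borel_measurable lebesgue"
  shows "(\<integral>\<^sup>+x. f x \<partial>lebesgue) = ennreal J * (\<integral>\<^sup>+x. f (T x) \<partial>lebesgue)"
proof -
  have "(\<integral>\<^sup>+x. f x \<partial>lebesgue) = (\<integral>\<^sup>+x. f x \<partial>density (distr lebesgue lebesgue T) (\<lambda>_. ennreal J))"
    using lebesgue_eq by simp
  also have "\<dots> = (\<integral>\<^sup>+x. ennreal J * f x \<partial>distr lebesgue lebesgue T)"
    by (subst nn_integral_density) auto
  also have "\<dots> = (\<integral>\<^sup>+x. ennreal J * f (T x) \<partial>lebesgue)"
    by (subst nn_integral_distr[OF T_measurable]) auto
  also have "\<dots> = ennreal J * (\<integral>\<^sup>+x. f (T x) \<partial>lebesgue)"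
    by (rule nn_integral_cmult) (rule measurable_comp, simp)
  finally show ?thesis .
qed

lemma integrable_comp_iff:
  fixes f :: "'a \<Rightarrow> real"
  shows "integrable lebesgue (\<lambda>x. f (T x)) \<longleftrightarrow> integrable lebesgue f"
proof (cases "f \<in> borel_measurable lebesgue")
  case True
  have "(\<integral>\<^sup>+x. norm (f x) \<partial>lebesgue) = ennreal J * (\<integral>\<^sup>+x. norm (f (T x)) \<partial>lebesgue)"
    using True by (subst nn_integral_comp) auto
  with True jacobian_pos show ?thesis
    by (auto simp: integrable_iff_bounded measurable_comp_iff ennreal_mult_less_top top_unique)
next
  case False
  then show ?thesis
    using measurable_comp_iff[of f borel] by (meson borel_measurable_integrable)
qed

lemma integral_comp:
  fixes f :: "'a \<Rightarrow> real"
  assumes [measurable]: "f \<in> borel_measurable lebesgue"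
  shows "(\<integral>x. f x \<partial>lebesgue) = J * (\<integral>x. f (T x) \<partial>lebesgue)"
proof -
  have "(\<integral>x. f x \<partial>lebesgue) = (\<integral>x. f x \<partial>density (distr lebesgue lebesgue T) (\<lambda>_. ennreal J))"
    using lebesgue_eq by simp
  also have "\<dots> = (\<integral>x. J *\<^sub>R f x \<partial>distr lebesgue lebesgue T)"
    using jacobian_pos by (subst integral_density) (auto intro: less_imp_le)
  also have "\<dots> = (\<integral>x. J *\<^sub>R f (T x) \<partial>lebesgue)"
    by (subst integral_distr[OF T_measurable]) auto
  finally show ?thesis by simp
qed

lemma vimage_sets: "S \<in> sets lebesgue \<Longrightarrow> T -` S \<in> sets lebesgue"
  using measurable_sets[OF T_measurable, of S] by simp

lemma vimage_sets_iff: "T -` S \<in> sets lebesgue \<longleftrightarrow> S \<in> sets lebesgue"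
proof
  assume "T -` S \<in> sets lebesgue"
  then have "Tinv -` (T -` S) \<in> sets lebesgue"
    using measurable_sets[OF Tinv_measurable, of "T -` S"] by simp
  then show "S \<in> sets lebesgue" by (simp add: vimage_def)
qed (rule vimage_sets)

lemma emeasure_vimage:
  assumes "S \<in> sets lebesgue"
  shows "emeasure lebesgue S = ennreal J * emeasure lebesgue (T -` S)"
proof -
  have "emeasure lebesgue S = (\<integral>\<^sup>+x. indicator S x \<partial>lebesgue)"
    using assms by simp
  also have "\<dots> = ennreal J * (\<integral>\<^sup>+x. indicator S (T x) \<partial>lebesgue)"
    using assms by (intro nn_integral_comp) auto
  also have "(\<lambda>x. indicator S (T x)) = (indicator (T -` S) :: 'a \<Rightarrow> ennreal)"
    by (auto simp: indicator_def)
  finally show ?thesis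
    using vimage_sets[OF assms] by simp
qed

lemma measure_vimage:
  assumes "S \<in> sets lebesgue"
  shows "measure lebesgue S = J * measure lebesgue (T -` S)"
  using emeasure_vimage[OF assms] jacobian_pos by (simp add: measure_def enn2real_mult)

lemma AE_comp_iff: "(AE x in lebesgue. P (T x)) \<longleftrightarrow> (AE x in lebesgue. P x)"
proof
  assume "AE x in lebesgue. P x"
  then obtain N where N: "{x. \<not> P x} \<subseteq> N" "emeasure lebesgue N = 0" "N \<in> sets lebesgue"
    by (auto elim!: AE_E)
  then have "emeasure lebesgue (T -` N) = 0"
    using emeasure_vimage[OF N(3)] jacobian_pos by auto
  then show "AE x in lebesgue. P (T x)"
    using N vimage_sets[OF N(3)] by (intro AE_I[of _ _ "T -` N"]) auto
next
  assume "AE x in lebesgue. P (T x)"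
  then obtain N where N: "{x. \<not> P (T x)} \<subseteq> N" "emeasure lebesgue N = 0" "N \<in> sets lebesgue"
    by (auto elim!: AE_E)
  have eq: "T -` (Tinv -` N) = N"
    by auto
  have m: "Tinv -` N \<in> sets lebesgue"
    using vimage_sets_iff[of "Tinv -` N"] N(3) eq by simp
  then have "emeasure lebesgue (Tinv -` N) = 0"
    using emeasure_vimage[OF m] N(2) eq by simp
  moreover have "{x. \<not> P x} \<subseteq> Tinv -` N"
  proof
    fix x assume "x \<in> {x. \<not> P x}"
    then have "Tinv x \<in> {x. \<not> P (T x)}" by simp
    with N(1) show "x \<in> Tinv -` N" by blast
  qed
  ultimately show "AE x in lebesgue. P x"
    using m by (intro AE_I[of _ _ "Tinv -` N"]) auto
qed

lemma esssup_comp: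
  fixes k :: "'a \<Rightarrow> ereal"
  assumes "S \<in> sets lebesgue"
  shows "esssup (lebesgue_on (T -` S)) (\<lambda>x. k (T x)) = esssup (lebesgue_on S) k"
proof -
  have m: "(\<lambda>x. k (T x)) \<in> borel_measurable (lebesgue_on (T -` S)) \<longleftrightarrow>
      k \<in> borel_measurable (lebesgue_on S)"
    using measurable_comp_iff[of "\<lambda>x. if x \<in> S then k x else 0" borel] assms vimage_sets[OF assms]
    by (simp add: measurable_restrict_space_iff[of _ _ 0])
  have "(AE x in lebesgue_on (T -` S). k (T x) \<le> z) \<longleftrightarrow> (AE x in lebesgue_on S. k x \<le> z)" for z
    using AE_comp_iff[of "\<lambda>x. x \<in> S \<longrightarrow> k x \<le> z"] assms vimage_sets[OF assms]
    by (simp add: AE_restrict_space_iff)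
  with m show ?thesis
    by (cases "k \<in> borel_measurable (lebesgue_on S)") (simp_all add: esssup_eq_AE esssup_non_measurable)
qed

end

section \<open>Weak derivatives\<close>

lemma integral_lebesgue_on:
  fixes f :: "'a::euclidean_space \<Rightarrow> real"
  assumes "U \<in> sets lebesgue"
  shows "(\<integral>x. f x \<partial>lebesgue_on U) = (\<integral>x. indicat_real U x * f x \<partial>lebesgue)"
  using assms by (simp add: integral_restrict_space)

lemma integrable_lebesgue_on:
  fixes f :: "'a::euclidean_space \<Rightarrow> real"
  assumes "U \<in> sets lebesgue"
  shows "integrable (lebesgue_on U) f \<longleftrightarrow> integrable lebesgue (\<lambda>x. indicat_real U x * f x)"
  using assms by (simp add: integrable_restrict_space)

lemma integral_lebesgue_on_eq_lebesgue:
  fixes f :: "'a::euclidean_space \<Rightarrow> real"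
  assumes "U \<in> sets lebesgue" "\<And>x. x \<notin> U \<Longrightarrow> f x = 0"
  shows "(\<integral>x. f x \<partial>lebesgue_on U) = (\<integral>x. f x \<partial>lebesgue)"
proof -
  have "(\<lambda>x. indicat_real U x * f x) = f"
    using assms(2) by (auto simp: fun_eq_iff indicator_def)
  then show ?thesis
    by (simp add: integral_lebesgue_on[OF assms(1)])
qed

lemma absolutely_integrable_onI:
  fixes f :: "'a::euclidean_space \<Rightarrow> real"
  assumes "integrable lebesgue f" "S \<in> sets lebesgue"
  shows "f absolutely_integrable_on S"
  using integrable_mult_indicator[OF assms(2,1)] unfolding set_integrable_def .

lemma test_function_zero:
  assumes "test_function U \<eta>" "z \<notin> U"
  shows "\<eta> z = 0"
  using assms unfolding test_function_def by blast

lemma test_function_deriv_zero: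
  assumes "test_function U \<eta>" "z \<notin> U"
  shows "frechet_derivative \<eta> (at z) = (\<lambda>_. 0)"
proof -
  obtain K where K: "compact K" "K \<subseteq> U" "\<And>z. z \<notin> K \<Longrightarrow> \<eta> z = 0"
    using assms(1) unfolding test_function_def by blast
  then show ?thesis
    using assms(2) by (intro frechet_derivative_zero_off_support[of K]) (auto intro: compact_imp_closed)
qed

lemma weak_deriv_restrict:
  assumes "weak_deriv UNIV b g h" "open U"
  shows "weak_deriv U b g h"
  unfolding weak_deriv_def
proof (intro conjI allI impI)
  fix K assume "compact K \<and> K \<subseteq> U"
  then show "g absolutely_integrable_on K" "h absolutely_integrable_on K"
    using assms(1) unfolding weak_deriv_def by (metis subset_UNIV)+
next
  fix \<eta> assume \<eta>: "test_function U \<eta>"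
  have U: "U \<in> sets lebesgue" using assms(2) by auto
  have "(\<integral>z. g z * frechet_derivative \<eta> (at z) b \<partial>lebesgue) = - (\<integral>z. h z * \<eta> z \<partial>lebesgue)"
    using assms(1) test_function_mono[OF \<eta>, of UNIV] by (simp add: weak_deriv_def lebesgue_on_UNIV_eq)
  then show "(\<integral>z. g z * frechet_derivative \<eta> (at z) b \<partial>lebesgue_on U) =
      - (\<integral>z. h z * \<eta> z \<partial>lebesgue_on U)"
    using test_function_zero[OF \<eta>] test_function_deriv_zero[OF \<eta>]
    by (simp add: integral_lebesgue_on_eq_lebesgue[OF U])
qed

lemma integrable_mult_test_function:
  assumes "test_function U \<eta>" "integrable M g" "sets M = sets lebesgue"
  shows "integrable M (\<lambda>z. g z * \<eta> z :: real)"
proof -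
  obtain C where C: "0 \<le> C" "\<And>z. \<bar>\<eta> z\<bar> \<le> C"
    using test_function_bounded[OF assms(1)] by blast
  have [measurable]: "\<eta> \<in> borel_measurable M"
    using test_function_measurable[OF assms(1)] measurable_cong_sets[OF assms(3) refl] by blast
  have "norm (g z * \<eta> z) \<le> norm (C * g z)" for z
    using C mult_mono[OF order_refl C(2)[of z], of "\<bar>g z\<bar>"] by (simp add: abs_mult mult.commute)
  then show ?thesis
    by (intro Bochner_Integration.integrable_bound[OF integrable_mult_right[OF assms(2), of C]] AE_I2)
      (use assms(2) in measurable)
qed

lemma weak_derivD:
  assumes "weak_deriv U b g h"
  shows "compact K \<Longrightarrow> K \<subseteq> U \<Longrightarrow> g absolutely_integrable_on K"
    and "compact K \<Longrightarrow> K \<subseteq> U \<Longrightarrow> h absolutely_integrable_on K"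
    and "test_function U \<eta> \<Longrightarrow> (\<integral>z. g z * frechet_derivative \<eta> (at z) b \<partial>lebesgue_on U) =
        - (\<integral>z. h z * \<eta> z \<partial>lebesgue_on U)"
  using assms unfolding weak_deriv_def by blast+

lemma weak_deriv_UNIV_I:
  assumes "\<And>K. compact K \<Longrightarrow> g absolutely_integrable_on K"
    and "\<And>K. compact K \<Longrightarrow> h absolutely_integrable_on K"
    and "\<And>\<eta>. test_function UNIV \<eta> \<Longrightarrow>
      (\<integral>z. g z * frechet_derivative \<eta> (at z) b \<partial>lebesgue) = - (\<integral>z. h z * \<eta> z \<partial>lebesgue)"
  shows "weak_deriv UNIV b g h"
  using assms unfolding weak_deriv_def lebesgue_on_UNIV_eq by blast

lemma integrable_mult_test_function_local:
  assumes "test_function U \<eta>" "\<And>K. compact K \<Longrightarrow> K \<subseteq> U \<Longrightarrow> g absolutely_integrable_on K"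
  shows "integrable lebesgue (\<lambda>z. g z * \<eta> z :: real)"
proof -
  obtain K where K: "compact K" "K \<subseteq> U" "\<And>z. z \<notin> K \<Longrightarrow> \<eta> z = 0"
    using assms(1) unfolding test_function_def by blast
  have "integrable lebesgue (\<lambda>z. indicat_real K z * g z)"
    using assms(2)[OF K(1,2)] by (simp add: set_integrable_def)
  from integrable_mult_test_function[OF assms(1) this refl]
  have "integrable lebesgue (\<lambda>z. indicat_real K z * g z * \<eta> z)" .
  also have "(\<lambda>z. indicat_real K z * g z * \<eta> z) = (\<lambda>z. g z * \<eta> z)"
    using K(3) by (auto simp: fun_eq_iff indicator_def)
  finally show ?thesis .
qed

lemma weak_deriv_integrable:
  assumes "weak_deriv U b g h" "test_function U \<eta>"
  shows "integrable lebesgue (\<lambda>z. g z * \<eta> z)" "integrable lebesgue (\<lambda>z. h z * \<eta> z)"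
  using assms(2) weak_derivD(1,2)[OF assms(1)]
  by (auto intro: integrable_mult_test_function_local)

lemma compact_in_sets_lebesgue: "compact K \<Longrightarrow> K \<in> sets lebesgue"
  for K :: "'a::euclidean_space set"
  using lmeasurable_compact fmeasurableD by blast

lemma weak_deriv_mult:
  assumes wd: "weak_deriv U b g h" and "open U" "b \<in> Basis" and \<theta>: "test_function U \<theta>"
  shows "weak_deriv UNIV b (\<lambda>z. g z * \<theta> z)
    (\<lambda>z. h z * \<theta> z + g z * frechet_derivative \<theta> (at z) b)"
proof (rule weak_deriv_UNIV_I)
  note loc = weak_deriv_integrable[OF wd]
  fix K :: "'a set" assume K: "compact K"
  show "(\<lambda>z. g z * \<theta> z) absolutely_integrable_on K"
    by (intro absolutely_integrable_onI loc \<theta> compact_in_sets_lebesgue K)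
  show "(\<lambda>z. h z * \<theta> z + g z * frechet_derivative \<theta> (at z) b) absolutely_integrable_on K"
    by (intro absolutely_integrable_onI Bochner_Integration.integrable_add loc \<theta>
        test_function_deriv assms(3) compact_in_sets_lebesgue K)
next
  note loc = weak_deriv_integrable[OF wd]
  fix \<eta> :: "'a \<Rightarrow> real" assume \<eta>: "test_function UNIV \<eta>"
  let ?d = "\<lambda>\<eta> z. frechet_derivative \<eta> (at z) b"
  have U: "U \<in> sets lebesgue" using \<open>open U\<close> by (simp add: borel_open)
  have tf: "test_function U (\<lambda>z. \<theta> z * \<eta> z)"
    using \<theta> test_function_times_cont_diff[OF \<eta>] by (rule test_function_mult)
  have tf1: "test_function U (\<lambda>z. \<theta> z * ?d \<eta> z)" "test_function U (\<lambda>z. ?d \<theta> z * \<eta> z)"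
    using \<theta> \<eta> assms(3)
    by (auto intro!: test_function_mult test_function_deriv
        intro: test_function_times_cont_diff[OF test_function_deriv] test_function_times_cont_diff[OF \<eta>])
  have d: "?d (\<lambda>z. \<theta> z * \<eta> z) z = \<theta> z * ?d \<eta> z + ?d \<theta> z * \<eta> z" for z
    using \<theta> \<eta> by (simp add: frechet_derivative_mult test_function_differentiable)
  have "(\<integral>z. g z * ?d (\<lambda>z. \<theta> z * \<eta> z) z \<partial>lebesgue) = - (\<integral>z. h z * (\<theta> z * \<eta> z) \<partial>lebesgue)"
    using weak_derivD(3)[OF wd tf] test_function_zero[OF tf] test_function_deriv_zero[OF tf]
    by (simp add: integral_lebesgue_on_eq_lebesgue[OF U])
  moreover have "(\<integral>z. g z * ?d (\<lambda>z. \<theta> z * \<eta> z) z \<partial>lebesgue) =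
      (\<integral>z. g z * (\<theta> z * ?d \<eta> z) \<partial>lebesgue) + (\<integral>z. g z * (?d \<theta> z * \<eta> z) \<partial>lebesgue)"
    unfolding d distrib_left by (intro Bochner_Integration.integral_add loc tf1)
  moreover have "(\<integral>z. (h z * \<theta> z + g z * ?d \<theta> z) * \<eta> z \<partial>lebesgue) =
      (\<integral>z. h z * (\<theta> z * \<eta> z) \<partial>lebesgue) + (\<integral>z. g z * (?d \<theta> z * \<eta> z) \<partial>lebesgue)"
    unfolding distrib_right mult.assoc by (intro Bochner_Integration.integral_add loc tf1 tf)
  ultimately show "(\<integral>z. g z * \<theta> z * ?d \<eta> z \<partial>lebesgue) =
      - (\<integral>z. (h z * \<theta> z + g z * ?d \<theta> z) * \<eta> z \<partial>lebesgue)"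
    by (simp add: mult.assoc)
qed

lemma weak_deriv_UNIV_add:
  assumes "weak_deriv UNIV b g h" "weak_deriv UNIV b g' h'" "b \<in> Basis"
  shows "weak_deriv UNIV b (\<lambda>z. g z + g' z) (\<lambda>z. h z + h' z)"
proof (rule weak_deriv_UNIV_I)
  fix K :: "'a set" assume K: "compact K"
  show "(\<lambda>z. g z + g' z) absolutely_integrable_on K" "(\<lambda>z. h z + h' z) absolutely_integrable_on K"
    using weak_derivD(1,2)[OF assms(1) K] weak_derivD(1,2)[OF assms(2) K]
    by (auto intro!: set_integral_add)
next
  fix \<eta> :: "'a \<Rightarrow> real" assume \<eta>: "test_function UNIV \<eta>"
  have d: "test_function UNIV (\<lambda>z. frechet_derivative \<eta> (at z) b)"
    using \<eta> assms(3) by (rule test_function_deriv)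
  have i: "integrable lebesgue (\<lambda>z. g z * frechet_derivative \<eta> (at z) b)"
     "integrable lebesgue (\<lambda>z. g' z * frechet_derivative \<eta> (at z) b)"
     "integrable lebesgue (\<lambda>z. h z * \<eta> z)" "integrable lebesgue (\<lambda>z. h' z * \<eta> z)"
    by (intro weak_deriv_integrable[OF assms(1)] weak_deriv_integrable[OF assms(2)] d \<eta>)+
  show "(\<integral>z. (g z + g' z) * frechet_derivative \<eta> (at z) b \<partial>lebesgue) =
      - (\<integral>z. (h z + h' z) * \<eta> z \<partial>lebesgue)"
    using weak_derivD(3)[OF assms(1) \<eta>] weak_derivD(3)[OF assms(2) \<eta>] i
    by (simp add: lebesgue_on_UNIV_eq distrib_right)
qed

lemma weak_deriv_UNIV_cmult:
  assumes "weak_deriv UNIV b g h"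
  shows "weak_deriv UNIV b (\<lambda>z. k * g z) (\<lambda>z. k * h z)"
proof (rule weak_deriv_UNIV_I)
  fix K :: "'a set" assume K: "compact K"
  show "(\<lambda>z. k * g z) absolutely_integrable_on K" "(\<lambda>z. k * h z) absolutely_integrable_on K"
    using weak_derivD(1,2)[OF assms K] by auto
next
  fix \<eta> :: "'a \<Rightarrow> real" assume \<eta>: "test_function UNIV \<eta>"
  show "(\<integral>z. k * g z * frechet_derivative \<eta> (at z) b \<partial>lebesgue) =
      - (\<integral>z. k * h z * \<eta> z \<partial>lebesgue)"
    using weak_derivD(3)[OF assms \<eta>] by (simp add: lebesgue_on_UNIV_eq mult.assoc)
qed

lemma weak_deriv_UNIV_diag_affine:
  fixes c :: "'a::euclidean_space \<Rightarrow> real"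
  assumes wd: "weak_deriv UNIV b g h" and b: "b \<in> Basis" and "nonsingular_diag c"
  shows "weak_deriv UNIV b (\<lambda>z. g (diag_affine c a z)) (\<lambda>z. c b * h (diag_affine c a z))"
proof -
  interpret nonsingular_diag c a by fact
  have cont: "continuous_on S T" for S
    unfolding diag_affine_def[abs_def] by (intro continuous_intros)
  have abs_int: "(\<lambda>z. k (T z)) absolutely_integrable_on K"
    if "compact K" "\<And>K. compact K \<Longrightarrow> k absolutely_integrable_on K" for k :: "'a \<Rightarrow> real" and K
  proof -
    have "compact (T ` K)"
      using cont that(1) by (rule compact_continuous_image)
    then have "integrable lebesgue (\<lambda>z. indicat_real (T ` K) z * k z)"
      using that(2) by (simp add: set_integrable_def)
    then have "integrable lebesgue (\<lambda>z. indicat_real (T ` K) (T z) * k (T z))"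
      by (subst integrable_comp_iff)
    moreover have "indicat_real (T ` K) (T z) = indicat_real K z" for z
      using bij_T by (auto simp: indicator_def bij_def inj_image_mem_iff)
    ultimately show ?thesis
      by (simp add: set_integrable_def)
  qed
  show ?thesis
  proof (rule weak_deriv_UNIV_I)
    fix K :: "'a set" assume K: "compact K"
    show "(\<lambda>z. g (T z)) absolutely_integrable_on K" "(\<lambda>z. c b * h (T z)) absolutely_integrable_on K"
      using abs_int[OF K weak_derivD(1)[OF wd]] abs_int[OF K weak_derivD(2)[OF wd]] by auto
  next
    fix \<eta> :: "'a \<Rightarrow> real" assume \<eta>: "test_function UNIV \<eta>"
    define \<zeta> where "\<zeta> z = \<eta> (Tinv z)" for z
    have \<zeta>T: "\<zeta> (T z) = \<eta> z" for z by (simp add: \<zeta>_def)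
    obtain K where K: "compact K" "\<And>z. z \<notin> K \<Longrightarrow> \<eta> z = 0"
      using \<eta> unfolding test_function_def by blast
    have "compact (T ` K)"
      using cont K(1) by (rule compact_continuous_image)
    moreover have "\<zeta> z = 0" if "z \<notin> T ` K" for z
      using that K(2)[of "Tinv z"] by (metis T_Tinv \<zeta>_def imageI)
    moreover have "times_cont_diff k \<zeta>" for k
      unfolding \<zeta>_def diag_affine_inv_def
      by (intro times_cont_diff_diag_affine test_function_times_cont_diff[OF \<eta>])
    ultimately have \<zeta>: "test_function UNIV \<zeta>"
      unfolding test_function_def by blast
    have d: "frechet_derivative \<eta> (at z) b = c b * frechet_derivative \<zeta> (at (T z)) b" for z
      using frechet_derivative_diag_affine[OF test_function_differentiable[OF \<zeta>] b, of c a z]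
      by (simp add: \<zeta>T)
    have m: "(\<lambda>z. g z * frechet_derivative \<zeta> (at z) b) \<in> borel_measurable lebesgue"
      "(\<lambda>z. h z * \<zeta> z) \<in> borel_measurable lebesgue"
      by (intro borel_measurable_integrable weak_deriv_integrable[OF wd] test_function_deriv \<zeta> b)+
    have "J * (\<integral>z. g (T z) * frechet_derivative \<zeta> (at (T z)) b \<partial>lebesgue) =
        J * - (\<integral>z. h (T z) * \<eta> z \<partial>lebesgue)"
      using weak_derivD(3)[OF wd \<zeta>] integral_comp[OF m(1)] integral_comp[OF m(2)]
      by (simp add: lebesgue_on_UNIV_eq \<zeta>T)
    then have "(\<integral>z. g (T z) * frechet_derivative \<zeta> (at (T z)) b \<partial>lebesgue) =
        - (\<integral>z. h (T z) * \<eta> z \<partial>lebesgue)"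
      using jacobian_pos by (simp only: mult_cancel_left) simp
    then show "(\<integral>z. g (T z) * frechet_derivative \<eta> (at z) b \<partial>lebesgue) =
        - (\<integral>z. c b * h (T z) * \<eta> z \<partial>lebesgue)"
      by (simp only: d mult.left_commute[of _ "c b"] mult.assoc integral_mult_right_zero mult_minus_right)
  qed
qed

section \<open>Even reflection in time\<close>

lemma step_deriv:
  obtains D C where "\<And>x. (step has_real_derivative D x) (at x)" "\<And>x. x < 0 \<or> 1 < x \<Longrightarrow> D x = 0"
    "0 \<le> C" "\<And>x. \<bar>D x\<bar> \<le> C"
proof -
  define D where "D x = frechet_derivative step (at x) 1" for x
  have tcd: "times_cont_diff k step" for k
    using times_cont_diff_step[OF times_cont_diff_linear[OF bounded_linear_ident]] .
  have diff: "step differentiable (at x)" for x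
    using tcd[of 1] by simp
  have D: "(step has_real_derivative D x) (at x)" for x
  proof -
    have "frechet_derivative step (at x) = (*) (D x)"
    proof
      fix y :: real
      show "frechet_derivative step (at x) y = D x * y"
        using linear_cmul[OF linear_frechet_derivative[OF diff[of x]], of y 1]
        by (simp add: D_def mult.commute)
    qed
    with has_derivative_frechet[OF diff[of x]] show ?thesis
      by (simp add: has_field_derivative_def)
  qed
  have D0: "D x = 0" if "x < 0 \<or> 1 < x" for x
  proof -
    have "(step has_real_derivative 0) (at x)"
    proof (cases "x < 0")
      case True
      then show ?thesis
        by (intro has_field_derivative_transform_within_open[OF DERIV_const[of 1], of "{..<0}"])
          (simp_all add: step_eq_1)
    next
      case False
      with that show ?thesis
        by (intro has_field_derivative_transform_within_open[OF DERIV_const[of 0], of "{1<..}"])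
          (simp_all add: step_eq_0)
    qed
    with D show ?thesis by (rule DERIV_unique)
  qed
  have "times_cont_diff k D" for k
    using tcd[of "Suc k"] by (simp add: D_def[abs_def])
  then have "test_function UNIV D"
    using D0 unfolding test_function_def
    by (intro conjI allI exI[of _ "{0..1}"]) (auto simp: not_le)
  then obtain C where "0 \<le> C" "\<And>x. \<bar>D x\<bar> \<le> C"
    using test_function_bounded by blast
  with D D0 that show thesis by blast
qed

text \<open>An integration by parts on \<open>W \<times> (s,T)\<close> for functions \<open>\<zeta>\<close> that need not vanish at the top:
  cut \<open>\<zeta>\<close> off at distance \<open>1/m\<close> from the top. In the time direction the derivative of the cutoff is
  of order \<open>m\<close>, which is compensated by \<open>|\<zeta>| \<le> C (T - t)\<close>.\<close>

lemma weak_deriv_up_to_top: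
  fixes W :: "'a::euclidean_space set" and b :: "'a \<times> real" and s T :: real
  defines "U \<equiv> W \<times> {s<..<T}"
  assumes wd: "weak_deriv U b g h" and "open W" and b: "b \<in> Basis"
    and g: "integrable (lebesgue_on U) g" and h: "integrable (lebesgue_on U) h"
    and \<zeta>: "test_function (W \<times> {s<..}) \<zeta>"
    and bnd: "\<And>z. z \<in> U \<Longrightarrow> \<bar>\<zeta> z * snd b\<bar> \<le> C * (T - snd z)"
  shows "(\<integral>z. g z * frechet_derivative \<zeta> (at z) b \<partial>lebesgue_on U) =
    - (\<integral>z. h z * \<zeta> z \<partial>lebesgue_on U)"
proof -
  let ?d = "\<lambda>\<eta> z. frechet_derivative \<eta> (at z) b"
  have "open U" unfolding U_def using \<open>open W\<close> by (intro open_Times) auto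
  then have U: "U \<in> sets lebesgue" by (simp add: borel_open)
  obtain D C' where D: "\<And>x. (step has_real_derivative D x) (at x)"
      "\<And>x. x < 0 \<or> 1 < x \<Longrightarrow> D x = 0" and C': "0 \<le> C'" "\<And>x. \<bar>D x\<bar> \<le> C'"
    using step_deriv by blast
  define \<tau> where "\<tau> m z = 2 - real (Suc m) * (T - snd z)" for m and z :: "'a \<times> real"
  define \<kappa> where "\<kappa> m z = step (\<tau> m z)" for m and z :: "'a \<times> real"
  have \<tau>: "times_cont_diff k (\<tau> m)" for k m
  proof -
    have "times_cont_diff k (\<lambda>z. (2 - real (Suc m) * T) + real (Suc m) * snd z)"
      by (intro times_cont_diff_add times_cont_diff_const times_cont_diff_cmult
          times_cont_diff_linear bounded_linear_snd)
    also have "(\<lambda>z. (2 - real (Suc m) * T) + real (Suc m) * snd z) = \<tau> m"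
      by (simp add: \<tau>_def fun_eq_iff algebra_simps)
    finally show ?thesis .
  qed
  then have \<kappa>: "times_cont_diff k (\<kappa> m)" for k m
    unfolding \<kappa>_def[abs_def] by (rule times_cont_diff_step)
  have d\<kappa>: "?d (\<kappa> m) z = D (\<tau> m z) * (real (Suc m) * snd b)" for m z
  proof -
    have "(\<tau> m has_derivative (\<lambda>h. real (Suc m) * snd h)) (at z)"
      unfolding \<tau>_def[abs_def] by (auto intro!: derivative_eq_intros simp: algebra_simps)
    from diff_chain_at[OF this D(1)[THEN has_field_derivative_imp_has_derivative]]
    have "(\<kappa> m has_derivative (\<lambda>h. D (\<tau> m z) * (real (Suc m) * snd h))) (at z)"
      by (simp add: \<kappa>_def[abs_def] o_def)
    then show ?thesis by (simp add: frechet_derivative_eqI)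
  qed
  define \<zeta>m where "\<zeta>m m z = \<zeta> z * \<kappa> m z" for m z
  have dm: "?d (\<zeta>m m) z = \<zeta> z * ?d (\<kappa> m) z + ?d \<zeta> z * \<kappa> m z" for m z
  proof -
    have "\<kappa> m differentiable (at z)"
      using \<kappa>[of "Suc 0" m] unfolding times_cont_diff.simps by blast
    then show ?thesis
      unfolding \<zeta>m_def[abs_def]
      by (subst frechet_derivative_mult) (simp_all add: test_function_differentiable[OF \<zeta>])
  qed
  have tm: "test_function U (\<zeta>m m)" for m
  proof -
    obtain K where K: "compact K" "K \<subseteq> W \<times> {s<..}" "\<And>z. z \<notin> K \<Longrightarrow> \<zeta> z = 0"
      using \<zeta> unfolding test_function_def by blast
    define K' where "K' = K \<inter> snd -` {..T - 1 / real (Suc m)}"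
    have "compact K'"
      unfolding K'_def by (intro compact_Int_closed K continuous_closed_vimage) (auto intro: continuous_intros)
    moreover have "K' \<subseteq> U"
    proof
      fix z assume z: "z \<in> K'"
      have "0 < 1 / real (Suc m)" by simp
      moreover have "snd z \<le> T - 1 / real (Suc m)"
        using z by (simp add: K'_def del: of_nat_Suc)
      ultimately have "snd z < T" by linarith
      with z K(2) show "z \<in> U" by (auto simp: K'_def U_def)
    qed
    moreover have "\<zeta>m m z = 0" if "z \<notin> K'" for z
    proof (cases "z \<in> K")
      case True
      with that have "T - snd z < 1 / real (Suc m)" by (auto simp: K'_def)
      then have "1 \<le> \<tau> m z"
        by (simp add: \<tau>_def field_simps del: of_nat_Suc)
      then show ?thesis by (simp add: \<zeta>m_def \<kappa>_def step_eq_0)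
    qed (simp add: K(3) \<zeta>m_def)
    moreover have "times_cont_diff k (\<zeta>m m)" for k
      unfolding \<zeta>m_def by (intro times_cont_diff_mult test_function_times_cont_diff[OF \<zeta>] \<kappa>)
    ultimately show ?thesis
      unfolding test_function_def by blast
  qed
  have ev: "eventually (\<lambda>m. \<tau> m z < 0) sequentially" if "z \<in> U" for z
  proof -
    have "0 < T - snd z" using that by (auto simp: U_def)
    then obtain N :: nat where "2 / (T - snd z) < real N"
      using reals_Archimedean2 by blast
    then have N: "2 < real N * (T - snd z)"
      using \<open>0 < T - snd z\<close> by (simp add: field_simps)
    have "\<tau> m z < 0" if "N \<le> m" for m
    proof -
      have "real N * (T - snd z) \<le> real (Suc m) * (T - snd z)"
        using that \<open>0 < T - snd z\<close> by (intro mult_right_mono) auto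
      with N show ?thesis unfolding \<tau>_def by linarith
    qed
    then show ?thesis by (rule eventually_sequentiallyI)
  qed
  have lim: "(\<lambda>m. ?d (\<zeta>m m) z) \<longlonglongrightarrow> ?d \<zeta> z" "(\<lambda>m. \<zeta>m m z) \<longlonglongrightarrow> \<zeta> z" if "z \<in> U" for z
  proof -
    have "eventually (\<lambda>m. ?d (\<zeta>m m) z = ?d \<zeta> z) sequentially"
      using ev[OF that] by eventually_elim (simp add: dm d\<kappa> D(2) \<kappa>_def step_eq_1)
    then show "(\<lambda>m. ?d (\<zeta>m m) z) \<longlonglongrightarrow> ?d \<zeta> z" by (rule tendsto_eventually)
    have "eventually (\<lambda>m. \<zeta>m m z = \<zeta> z) sequentially"
      using ev[OF that] by eventually_elim (simp add: \<zeta>m_def \<kappa>_def step_eq_1)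
    then show "(\<lambda>m. \<zeta>m m z) \<longlonglongrightarrow> \<zeta> z" by (rule tendsto_eventually)
  qed
  obtain B1 where B1: "0 \<le> B1" "\<And>z. \<bar>\<zeta> z\<bar> \<le> B1"
    using test_function_bounded[OF \<zeta>] by blast
  obtain B2 where B2: "0 \<le> B2" "\<And>z. \<bar>?d \<zeta> z\<bar> \<le> B2"
    using test_function_bounded[OF test_function_deriv[OF \<zeta> b]] by blast
  have \<kappa>1: "\<bar>\<kappa> m z\<bar> \<le> 1" for m z
    using step_bounds[of "\<tau> m z"] by (auto simp: \<kappa>_def)
  have b1: "\<bar>\<zeta>m m z\<bar> \<le> B1" for m z
    using mult_mono[OF B1(2)[of z] \<kappa>1[of m z]] B1(1) by (simp add: \<zeta>m_def abs_mult)
  have b2: "\<bar>?d (\<zeta>m m) z\<bar> \<le> 2 * \<bar>C\<bar> * C' + B2" if "z \<in> U" for m z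
  proof -
    have t: "0 < T - snd z" using that by (auto simp: U_def)
    have "\<bar>\<zeta> z * ?d (\<kappa> m) z\<bar> \<le> 2 * \<bar>C\<bar> * C'"
    proof (cases "D (\<tau> m z) = 0")
      case True
      with C' show ?thesis by (simp add: d\<kappa>)
    next
      case False
      then have "0 \<le> \<tau> m z" using D(2)[of "\<tau> m z"] by linarith
      then have "real (Suc m) * (T - snd z) \<le> 2" by (simp add: \<tau>_def)
      have "\<bar>\<zeta> z * snd b\<bar> \<le> \<bar>C\<bar> * (T - snd z)"
        using bnd[OF that] mult_right_mono[OF abs_ge_self[of C] less_imp_le[OF t]] by linarith
      then have "real (Suc m) * \<bar>\<zeta> z * snd b\<bar> \<le> real (Suc m) * (\<bar>C\<bar> * (T - snd z))"
        by (rule mult_left_mono) simp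
      moreover have "\<bar>C\<bar> * (real (Suc m) * (T - snd z)) \<le> \<bar>C\<bar> * 2"
        by (rule mult_left_mono) (fact, simp)
      ultimately have "real (Suc m) * \<bar>\<zeta> z * snd b\<bar> \<le> 2 * \<bar>C\<bar>"
        by (simp only: mult.left_commute[of "real (Suc m)" "\<bar>C\<bar>"] mult.commute[of 2])
      then have "(real (Suc m) * \<bar>\<zeta> z * snd b\<bar>) * \<bar>D (\<tau> m z)\<bar> \<le> (2 * \<bar>C\<bar>) * C'"
        by (rule mult_mono) (use C' in simp_all)
      then show ?thesis by (simp add: d\<kappa> abs_mult mult_ac)
    qed
    moreover have "\<bar>?d \<zeta> z * \<kappa> m z\<bar> \<le> B2"
      using mult_mono[OF B2(2)[of z] \<kappa>1[of m z]] B2(1) by (simp add: abs_mult)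
    ultimately show ?thesis unfolding dm by linarith
  qed
  have meas: "\<eta> \<in> borel_measurable (lebesgue_on U)" if "test_function V \<eta>" for V and \<eta> :: "'a \<times> real \<Rightarrow> real"
    using test_function_measurable[OF that] by (rule measurable_restrict_space1)
  have L1: "(\<lambda>m. \<integral>z. g z * ?d (\<zeta>m m) z \<partial>lebesgue_on U) \<longlonglongrightarrow> (\<integral>z. g z * ?d \<zeta> z \<partial>lebesgue_on U)"
  proof (rule integral_dominated_convergence)
    show "integrable (lebesgue_on U) (\<lambda>z. (2 * \<bar>C\<bar> * C' + B2) * \<bar>g z\<bar>)"
      using g by simp
    show "AE z in lebesgue_on U. (\<lambda>m. g z * ?d (\<zeta>m m) z) \<longlonglongrightarrow> g z * ?d \<zeta> z"
      using lim(1) by (intro AE_I2 tendsto_mult_left) auto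
    show "AE z in lebesgue_on U. norm (g z * ?d (\<zeta>m m) z) \<le> (2 * \<bar>C\<bar> * C' + B2) * \<bar>g z\<bar>" for m
      using b2 by (intro AE_I2) (auto simp: abs_mult mult.commute[of "\<bar>g _\<bar>"] intro!: mult_right_mono)
  qed (use g meas[OF test_function_deriv[OF tm b]] meas[OF test_function_deriv[OF \<zeta> b]] in auto)
  have L2: "(\<lambda>m. \<integral>z. h z * \<zeta>m m z \<partial>lebesgue_on U) \<longlonglongrightarrow> (\<integral>z. h z * \<zeta> z \<partial>lebesgue_on U)"
  proof (rule integral_dominated_convergence)
    show "integrable (lebesgue_on U) (\<lambda>z. B1 * \<bar>h z\<bar>)"
      using h by simp
    show "AE z in lebesgue_on U. (\<lambda>m. h z * \<zeta>m m z) \<longlonglongrightarrow> h z * \<zeta> z"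
      using lim(2) by (intro AE_I2 tendsto_mult_left) auto
    show "AE z in lebesgue_on U. norm (h z * \<zeta>m m z) \<le> B1 * \<bar>h z\<bar>" for m
      using b1 by (intro AE_I2) (auto simp: abs_mult mult.commute[of "\<bar>h _\<bar>"] intro!: mult_right_mono)
  qed (use h meas[OF tm] meas[OF \<zeta>] in auto)
  show ?thesis
    using L1 tendsto_minus[OF L2] unfolding weak_derivD(3)[OF wd tm] by (rule LIMSEQ_unique)
qed


definition time_sign :: "'a::euclidean_space \<times> real \<Rightarrow> real" where
  "time_sign j = (if snd j = 0 then 1 else - 1)"

abbreviation time_reflection :: "real \<Rightarrow> 'a::euclidean_space \<times> real \<Rightarrow> 'a \<times> real" where
  "time_reflection T \<equiv> diag_affine time_sign (0, 2 * T)"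

lemma time_reflection_eq: "time_reflection T z = (fst z, 2 * T - snd z)"
proof (rule euclidean_eqI)
  fix j :: "'a \<times> real" assume "j \<in> Basis"
  then show "time_reflection T z \<bullet> j = (fst z, 2 * T - snd z) \<bullet> j"
    unfolding inner_diag_affine[OF \<open>j \<in> Basis\<close>]
    by (auto simp: Basis_prod_def time_sign_def inner_prod_def)
qed

interpretation time_reflection: nonsingular_diag time_sign "(0, 2 * T)" for T
  by unfold_locales (simp add: time_sign_def)

lemma time_reflection_jacobian: "nonsingular_diag.J (time_sign :: 'a::euclidean_space \<times> real \<Rightarrow> real) = 1"
  by (auto simp: time_reflection.J_def time_sign_def intro!: prod.neutral)

lemma AE_snd_neq: "AE z in lebesgue. snd (z :: 'a::euclidean_space \<times> real) \<noteq> T"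
proof (rule AE_I')
  have "negligible {z :: 'a \<times> real. (0, 1) \<bullet> z = T}"
    by (rule negligible_hyperplane) (simp add: zero_prod_def)
  then show "{z :: 'a \<times> real. (0, 1) \<bullet> z = T} \<in> null_sets lebesgue"
    by (simp add: negligible_iff_null_sets)
qed (auto simp: inner_prod_def)

text \<open>Values on the top \<open>t = T\<close> are those of \<open>g\<close> and are not doubled, so that the extension agrees
  with \<open>g\<close> pointwise; this matters for test functions.\<close>

definition reflect :: "'a::euclidean_space set \<Rightarrow> real \<Rightarrow> real \<Rightarrow> real \<Rightarrow> ('a \<times> real \<Rightarrow> real) \<Rightarrow>
    'a \<times> real \<Rightarrow> real" where
  "reflect W s T \<sigma> g z = indicat_real (W \<times> {s<..T}) z * g z +
     \<sigma> * (indicat_real (W \<times> {s<..<T}) (time_reflection T z) * g (time_reflection T z))"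

lemma lebesgue_sets_cylinder:
  fixes W :: "'a::euclidean_space set"
  assumes "open W"
  shows "W \<times> {s<..<T::real} \<in> sets lebesgue" "W \<times> {s<..T} \<in> sets lebesgue"
  using assms by (auto intro!: sets_completionI_sets simp: borel_prod[symmetric])

lemma AE_indicator_cylinder:
  fixes W :: "'a::euclidean_space set" and s T :: real
  shows "AE z in lebesgue. indicat_real (W \<times> {s<..T}) z = indicat_real (W \<times> {s<..<T}) z"
  using AE_snd_neq[of T] by eventually_elim (auto simp: indicator_def)

lemma integrable_reflect:
  assumes "open W" "integrable (lebesgue_on (W \<times> {s<..T})) g"
  shows "integrable lebesgue (reflect W s T \<sigma> g)" "integrable (lebesgue_on (W \<times> {s<..<T})) g"
    "integrable lebesgue (\<lambda>z. indicat_real (W \<times> {s<..<T}) (time_reflection T z) * g (time_reflection T z))"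
proof -
  note sets = lebesgue_sets_cylinder[OF assms(1)]
  have i: "integrable lebesgue (\<lambda>z. indicat_real (W \<times> {s<..T}) z * g z)"
    using assms(2) sets by (simp add: integrable_lebesgue_on)
  from integrable_mult_indicator[OF sets(1)[of s T] i]
  have "integrable lebesgue (\<lambda>z. indicat_real (W \<times> {s<..<T}) z *\<^sub>R (indicat_real (W \<times> {s<..T}) z * g z))" .
  also have "(\<lambda>z. indicat_real (W \<times> {s<..<T}) z *\<^sub>R (indicat_real (W \<times> {s<..T}) z * g z)) =
      (\<lambda>z. indicat_real (W \<times> {s<..<T}) z * g z)"
    by (auto simp: fun_eq_iff indicator_def)
  finally have j: "integrable lebesgue (\<lambda>z. indicat_real (W \<times> {s<..<T}) z * g z)" .
  then show "integrable (lebesgue_on (W \<times> {s<..<T})) g"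
    using sets by (simp add: integrable_lebesgue_on)
  show k: "integrable lebesgue
      (\<lambda>z. indicat_real (W \<times> {s<..<T}) (time_reflection T z) * g (time_reflection T z))"
    using j by (subst time_reflection.integrable_comp_iff)
  show "integrable lebesgue (reflect W s T \<sigma> g)"
    unfolding reflect_def[abs_def] using i k by simp
qed

lemma integral_reflect_test_function:
  assumes "open W" "integrable (lebesgue_on (W \<times> {s<..T})) g" "test_function V \<eta>"
  shows "(\<integral>z. reflect W s T \<sigma> g z * \<eta> z \<partial>lebesgue) =
    (\<integral>z. g z * (\<eta> z + \<sigma> * \<eta> (time_reflection T z)) \<partial>lebesgue_on (W \<times> {s<..<T}))"
proof -
  let ?U = "W \<times> {s<..<T}" and ?R = "time_reflection T"
  note sets = lebesgue_sets_cylinder[OF assms(1)]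
  have i: "integrable lebesgue (\<lambda>z. indicat_real (W \<times> {s<..T}) z * g z)"
    "integrable lebesgue (\<lambda>z. indicat_real ?U z * g z)"
    using assms(2) integrable_reflect[OF assms(1,2)] sets by (simp_all add: integrable_lebesgue_on)
  have i1: "integrable lebesgue (\<lambda>z. indicat_real (W \<times> {s<..T}) z * g z * \<eta> z)"
    "integrable lebesgue (\<lambda>z. indicat_real ?U z * g z * \<eta> z)"
    by (rule integrable_mult_test_function[OF assms(3) _ refl], rule i)+
  have i2: "integrable lebesgue (\<lambda>z. indicat_real ?U (?R z) * g (?R z) * \<eta> z)"
    by (rule integrable_mult_test_function[OF assms(3) integrable_reflect(3)[OF assms(1,2)] refl])
  have RR: "?R (?R z) = z" for z :: "'a \<times> real"
    by (simp add: time_reflection_eq)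
  have i3: "integrable lebesgue (\<lambda>z. indicat_real ?U z * g z * \<eta> (?R z))"
    using time_reflection.integrable_comp_iff[of "\<lambda>z. indicat_real ?U z * g z * \<eta> (?R z)" T] i2
    by (simp add: RR)
  have "(\<integral>z. reflect W s T \<sigma> g z * \<eta> z \<partial>lebesgue) =
      (\<integral>z. indicat_real (W \<times> {s<..T}) z * g z * \<eta> z +
        \<sigma> * (indicat_real ?U (?R z) * g (?R z) * \<eta> z) \<partial>lebesgue)"
    by (simp add: reflect_def algebra_simps)
  also have "\<dots> = (\<integral>z. indicat_real (W \<times> {s<..T}) z * g z * \<eta> z \<partial>lebesgue) +
      \<sigma> * (\<integral>z. indicat_real ?U (?R z) * g (?R z) * \<eta> z \<partial>lebesgue)"
    using i1 i2 by simp
  also have "(\<integral>z. indicat_real (W \<times> {s<..T}) z * g z * \<eta> z \<partial>lebesgue) =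
      (\<integral>z. indicat_real ?U z * g z * \<eta> z \<partial>lebesgue)"
    using AE_indicator_cylinder[of W s T] i1
    by (intro integral_cong_AE) (auto elim: eventually_mono)
  also have "(\<integral>z. indicat_real ?U (?R z) * g (?R z) * \<eta> z \<partial>lebesgue) =
      (\<integral>z. indicat_real ?U z * g z * \<eta> (?R z) \<partial>lebesgue)"
    using time_reflection.integral_comp[of "\<lambda>z. indicat_real ?U z * g z * \<eta> (?R z)" T] i3
    by (simp add: RR time_reflection_jacobian)
  also have "(\<integral>z. indicat_real ?U z * g z * \<eta> z \<partial>lebesgue) +
      \<sigma> * (\<integral>z. indicat_real ?U z * g z * \<eta> (?R z) \<partial>lebesgue) =
      (\<integral>z. indicat_real ?U z * g z * \<eta> z + \<sigma> * (indicat_real ?U z * g z * \<eta> (?R z)) \<partial>lebesgue)"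
    using i1 i3 by simp
  also have "\<dots> = (\<integral>z. g z * (\<eta> z + \<sigma> * \<eta> (?R z)) \<partial>lebesgue_on ?U)"
    using sets by (simp add: integral_lebesgue_on algebra_simps)
  finally show ?thesis .
qed

lemma test_function_time_lipschitz:
  fixes \<eta> :: "'a::euclidean_space \<times> real \<Rightarrow> real"
  assumes "test_function U \<eta>"
  obtains B where "0 \<le> B" "\<And>x t t'. \<bar>\<eta> (x, t) - \<eta> (x, t')\<bar> \<le> B * \<bar>t - t'\<bar>"
proof -
  have b: "(0, 1) \<in> (Basis :: ('a \<times> real) set)" by (simp add: Basis_prod_def)
  obtain B where B: "0 \<le> B" "\<And>z. \<bar>frechet_derivative \<eta> (at z) (0, 1)\<bar> \<le> B"
    using test_function_bounded[OF test_function_deriv[OF assms b]] by blast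
  have "((\<lambda>t. \<eta> (x, t)) has_real_derivative frechet_derivative \<eta> (at (x, t)) (0, 1)) (at t)" for x t
  proof -
    have "((\<lambda>t. (x, t)) has_derivative (\<lambda>h. (0, h))) (at t)"
      by (auto intro!: derivative_eq_intros)
    from diff_chain_at[OF this has_derivative_frechet[OF test_function_differentiable[OF assms]]]
    have "((\<lambda>t. \<eta> (x, t)) has_derivative (\<lambda>h. frechet_derivative \<eta> (at (x, t)) (0, h))) (at t)"
      by (simp add: o_def)
    moreover have "(\<lambda>h. frechet_derivative \<eta> (at (x, t)) (0, h)) =
        (*) (frechet_derivative \<eta> (at (x, t)) (0, 1))"
    proof
      fix h
      show "frechet_derivative \<eta> (at (x, t)) (0, h) = frechet_derivative \<eta> (at (x, t)) (0, 1) * h"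
        using linear_cmul[OF linear_frechet_derivative[OF test_function_differentiable[OF assms, of "(x, t)"]],
            of h "(0, 1)"] by (simp add: mult.commute)
    qed
    ultimately show ?thesis
      unfolding has_field_derivative_def by simp
  qed
  then have "norm (\<eta> (x, t) - \<eta> (x, t')) \<le> B * norm (t - t')" for x t t'
    using B by (intro field_differentiable_bound[of UNIV "\<lambda>t. \<eta> (x, t)"
          "\<lambda>t. frechet_derivative \<eta> (at (x, t)) (0, 1)"]) auto
  with B that show thesis by auto
qed

lemma weak_deriv_reflect:
  fixes W :: "'a::euclidean_space set" and b :: "'a \<times> real" and s T :: real
  assumes wd: "weak_deriv (W \<times> {s<..<T}) b g h" and "open W" and b: "b \<in> Basis"
    and g: "integrable (lebesgue_on (W \<times> {s<..T})) g"
    and h: "integrable (lebesgue_on (W \<times> {s<..T})) h"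
  shows "weak_deriv (W \<times> {s<..<2 * T - s}) b (reflect W s T 1 g) (reflect W s T (time_sign b) h)"
  unfolding weak_deriv_def
proof (intro conjI allI impI)
  fix K assume "compact K \<and> K \<subseteq> W \<times> {s<..<2 * T - s}"
  then show "reflect W s T 1 g absolutely_integrable_on K"
    "reflect W s T (time_sign b) h absolutely_integrable_on K"
    using integrable_reflect(1)[OF \<open>open W\<close>] g h
    by (auto intro!: absolutely_integrable_onI compact_in_sets_lebesgue)
next
  let ?D = "W \<times> {s<..<2 * T - s}" and ?U = "W \<times> {s<..<T}" and ?R = "time_reflection T"
  let ?d = "\<lambda>\<eta> z. frechet_derivative \<eta> (at z) b"
  fix \<eta> assume \<eta>: "test_function ?D \<eta>"
  define \<zeta> where "\<zeta> z = \<eta> z + time_sign b * \<eta> (?R z)" for z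
  have sq: "time_sign b * (time_sign b * x) = x" for x
    by (simp add: time_sign_def)
  have diff: "(\<lambda>z. \<eta> (?R z)) differentiable (at z)" for z
    using times_cont_diff_diag_affine[OF test_function_times_cont_diff[OF \<eta>, of "Suc 0"]]
    unfolding times_cont_diff.simps by blast
  have d\<zeta>: "?d \<zeta> z = ?d \<eta> z + ?d \<eta> (?R z)" for z
  proof -
    have "?d \<zeta> z = ?d \<eta> z + time_sign b * ?d (\<lambda>z. \<eta> (?R z)) z"
      unfolding \<zeta>_def[abs_def]
      by (subst frechet_derivative_eqI[OF has_derivative_add[OF
            has_derivative_frechet[OF test_function_differentiable[OF \<eta>]]
            has_derivative_mult_right[OF has_derivative_frechet[OF diff]]]]) simp
    then show ?thesis
      using frechet_derivative_diag_affine[OF test_function_differentiable[OF \<eta>] b, of time_sign "(0, 2 * T)" z]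
      by (simp add: sq)
  qed
  have \<zeta>: "test_function (W \<times> {s<..}) \<zeta>"
  proof -
    obtain K where K: "compact K" "K \<subseteq> ?D" "\<And>z. z \<notin> K \<Longrightarrow> \<eta> z = 0"
      using \<eta> unfolding test_function_def by blast
    have "continuous_on K ?R"
      unfolding time_reflection_eq[abs_def] by (intro continuous_intros)
    then have "compact (K \<union> ?R ` K)"
      using K(1) by (intro compact_Un compact_continuous_image)
    moreover have "K \<union> ?R ` K \<subseteq> W \<times> {s<..}"
      using K(2) by (force simp: time_reflection_eq)
    moreover have "\<zeta> z = 0" if "z \<notin> K \<union> ?R ` K" for z
    proof -
      have "?R z \<notin> K"
      proof
        assume "?R z \<in> K"
        then have "?R (?R z) \<in> ?R ` K" by (rule imageI)
        with that show False by (simp add: time_reflection_eq)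
      qed
      with that show ?thesis by (simp add: \<zeta>_def K(3))
    qed
    moreover have "times_cont_diff k \<zeta>" for k
      unfolding \<zeta>_def by (intro times_cont_diff_add times_cont_diff_cmult times_cont_diff_diag_affine
          test_function_times_cont_diff[OF \<eta>])
    ultimately show ?thesis
      unfolding test_function_def by blast
  qed
  obtain B where B: "0 \<le> B" "\<And>x t t'. \<bar>\<eta> (x, t) - \<eta> (x, t')\<bar> \<le> B * \<bar>t - t'\<bar>"
    using test_function_time_lipschitz[OF \<eta>] by blast
  have bnd: "\<bar>\<zeta> z * snd b\<bar> \<le> (2 * B) * (T - snd z)" if "z \<in> ?U" for z
  proof (cases "snd b = 0")
    case True
    with that B(1) show ?thesis by auto
  next
    case False
    then have "b = (0, 1)" using b by (auto simp: Basis_prod_def)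
    then have "\<zeta> z * snd b = \<eta> (fst z, snd z) - \<eta> (fst z, 2 * T - snd z)"
      by (simp add: \<zeta>_def time_sign_def time_reflection_eq)
    also have "\<bar>\<dots>\<bar> \<le> B * \<bar>snd z - (2 * T - snd z)\<bar>"
      by (rule B(2))
    also have "\<bar>snd z - (2 * T - snd z)\<bar> = 2 * (T - snd z)"
      using that by auto
    finally show ?thesis by (simp add: mult.assoc mult.left_commute)
  qed
  note gh = integrable_reflect(2)[OF \<open>open W\<close> g] integrable_reflect(2)[OF \<open>open W\<close> h]
  have D: "?D \<in> sets lebesgue"
    using \<open>open W\<close> by (rule lebesgue_sets_cylinder)
  have "(\<integral>z. reflect W s T 1 g z * ?d \<eta> z \<partial>lebesgue) = (\<integral>z. g z * ?d \<zeta> z \<partial>lebesgue_on ?U)"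
    unfolding d\<zeta> using integral_reflect_test_function[OF \<open>open W\<close> g test_function_deriv[OF \<eta> b], of 1]
    by simp
  also have "\<dots> = - (\<integral>z. h z * \<zeta> z \<partial>lebesgue_on ?U)"
    using wd \<open>open W\<close> b gh \<zeta> bnd by (rule weak_deriv_up_to_top)
  also have "\<dots> = - (\<integral>z. reflect W s T (time_sign b) h z * \<eta> z \<partial>lebesgue)"
    unfolding \<zeta>_def using integral_reflect_test_function[OF \<open>open W\<close> h \<eta>] by simp
  finally show "(\<integral>z. reflect W s T 1 g z * ?d \<eta> z \<partial>lebesgue_on ?D) =
      - (\<integral>z. reflect W s T (time_sign b) h z * \<eta> z \<partial>lebesgue_on ?D)"
    using test_function_zero[OF \<eta>] test_function_deriv_zero[OF \<eta>]
    by (simp add: integral_lebesgue_on_eq_lebesgue[OF D])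
qed

section \<open>Lebesgue and Sobolev spaces\<close>

lemma Lp_UNIV_iff:
  "g \<in> Lp p UNIV \<longleftrightarrow> g \<in> borel_measurable lebesgue \<and> integrable lebesgue (\<lambda>z. \<bar>g z\<bar> powr p)"
  by (simp add: Lp_def lebesgue_on_UNIV_eq)

lemma Lp_iff_indicator:
  assumes "Q \<in> sets lebesgue"
  shows "g \<in> Lp p Q \<longleftrightarrow> (\<lambda>z. indicat_real Q z * g z) \<in> Lp p UNIV"
proof -
  have "(\<lambda>z. \<bar>indicat_real Q z * g z\<bar> powr p) = (\<lambda>z. indicat_real Q z * \<bar>g z\<bar> powr p)"
    by (auto simp: fun_eq_iff indicator_def)
  then show ?thesis
    using assms unfolding Lp_def
    by (simp add: lebesgue_on_UNIV_eq integrable_lebesgue_on borel_measurable_restrict_space_iff mult.commute)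
qed

lemma Lp_bound:
  assumes "g \<in> Lp p UNIV" "0 \<le> p" "f \<in> borel_measurable lebesgue" "\<And>z. \<bar>f z\<bar> \<le> C * \<bar>g z\<bar>" "0 \<le> C"
  shows "f \<in> Lp p UNIV"
proof -
  have "\<bar>f z\<bar> powr p \<le> C powr p * \<bar>g z\<bar> powr p" for z
    using powr_mono2[OF assms(2) abs_ge_zero assms(4)[of z]] assms(5) by (simp add: powr_mult)
  moreover have "integrable lebesgue (\<lambda>z. C powr p * \<bar>g z\<bar> powr p)"
    using assms(1) by (simp add: Lp_UNIV_iff)
  moreover have "(\<lambda>z. \<bar>f z\<bar> powr p) \<in> borel_measurable lebesgue"
    using assms(3) by measurable
  ultimately have "integrable lebesgue (\<lambda>z. \<bar>f z\<bar> powr p)"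
    by (rule_tac Bochner_Integration.integrable_bound[OF _ _ AE_I2, of _ "\<lambda>z. C powr p * \<bar>g z\<bar> powr p"]) simp_all
  with assms(3) show ?thesis by (simp add: Lp_UNIV_iff)
qed

lemma Lp_mono:
  assumes "g \<in> Lp p UNIV" "Q \<in> sets lebesgue" "0 \<le> p"
  shows "g \<in> Lp p Q"
  unfolding Lp_iff_indicator[OF assms(2)]
proof (rule Lp_bound[of g p _ 1])
  show "(\<lambda>z. indicat_real Q z * g z) \<in> borel_measurable lebesgue"
    using assms by (intro borel_measurable_times borel_measurable_indicator) (auto simp: Lp_UNIV_iff)
qed (use assms in \<open>auto simp: indicator_def\<close>)

lemma Lp_add:
  assumes "f \<in> Lp p UNIV" "g \<in> Lp p UNIV" "0 \<le> p"
  shows "(\<lambda>z. f z + g z) \<in> Lp p UNIV"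
proof -
  have m: "f \<in> borel_measurable lebesgue" "g \<in> borel_measurable lebesgue"
    using assms by (simp_all add: Lp_UNIV_iff)
  have "\<bar>f z + g z\<bar> powr p \<le> 2 powr p * (\<bar>f z\<bar> powr p + \<bar>g z\<bar> powr p)" for z
  proof -
    have "\<bar>f z + g z\<bar> powr p \<le> (2 * max \<bar>f z\<bar> \<bar>g z\<bar>) powr p"
      using assms(3) by (intro powr_mono2) auto
    also have "\<dots> = 2 powr p * max \<bar>f z\<bar> \<bar>g z\<bar> powr p"
      by (simp add: powr_mult)
    also have "\<dots> \<le> 2 powr p * (\<bar>f z\<bar> powr p + \<bar>g z\<bar> powr p)"
      by (intro mult_left_mono) (auto simp: max_def)
    finally show ?thesis .
  qed
  moreover have "integrable lebesgue (\<lambda>z. 2 powr p * (\<bar>f z\<bar> powr p + \<bar>g z\<bar> powr p))"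
    using assms by (simp add: Lp_UNIV_iff)
  moreover have "(\<lambda>z. \<bar>f z + g z\<bar> powr p) \<in> borel_measurable lebesgue"
    using m by measurable
  ultimately have "integrable lebesgue (\<lambda>z. \<bar>f z + g z\<bar> powr p)"
    by (rule_tac Bochner_Integration.integrable_bound[OF _ _ AE_I2,
          of _ "\<lambda>z. 2 powr p * (\<bar>f z\<bar> powr p + \<bar>g z\<bar> powr p)"]) simp_all
  with m show ?thesis by (simp add: Lp_UNIV_iff)
qed

lemma Lp_cmult:
  assumes "g \<in> Lp p UNIV" "0 \<le> p"
  shows "(\<lambda>z. k * g z) \<in> Lp p UNIV"
proof (rule Lp_bound[OF assms, of _ "\<bar>k\<bar>"])
  show "(\<lambda>z. k * g z) \<in> borel_measurable lebesgue"
    using assms(1) by (intro borel_measurable_times borel_measurable_const) (simp add: Lp_UNIV_iff)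
qed (simp_all add: abs_mult)

lemma Lp_mult_test_function:
  assumes "g \<in> Lp p UNIV" "0 \<le> p" "test_function U \<eta>"
  shows "(\<lambda>z. g z * \<eta> z) \<in> Lp p UNIV"
proof -
  obtain C where C: "0 \<le> C" "\<And>z. \<bar>\<eta> z\<bar> \<le> C"
    using test_function_bounded[OF assms(3)] by blast
  show ?thesis
  proof (rule Lp_bound[of g p _ C])
    show "(\<lambda>z. g z * \<eta> z) \<in> borel_measurable lebesgue"
      using assms(1) test_function_measurable[OF assms(3)]
      by (intro borel_measurable_times) (simp_all add: Lp_UNIV_iff)
    show "\<bar>g z * \<eta> z\<bar> \<le> C * \<bar>g z\<bar>" for z
      using C(2)[of z] by (simp add: abs_mult mult.commute mult_right_mono)
  qed (use assms C in auto)
qed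

lemma Lp_diag_affine:
  assumes "g \<in> Lp p UNIV" "nonsingular_diag c"
  shows "(\<lambda>z. g (diag_affine c a z)) \<in> Lp p UNIV"
proof -
  interpret nonsingular_diag c a by fact
  show ?thesis
    using assms(1) integrable_comp_iff[of "\<lambda>z. \<bar>g z\<bar> powr p"]
    by (simp add: Lp_UNIV_iff measurable_comp_iff)
qed

lemma integrable_Lp:
  assumes "g \<in> Lp p Q" "1 \<le> p" "Q \<in> lmeasurable"
  shows "integrable (lebesgue_on Q) g"
proof -
  have "integrable (lebesgue_on Q) (\<lambda>z. 1 :: real)"
    using assms(3) by (simp add: integrable_lebesgue_on fmeasurableD lmeasurable_iff_integrable)
  moreover have "\<bar>g z\<bar> \<le> 1 + \<bar>g z\<bar> powr p" for z
  proof (cases "\<bar>g z\<bar> \<le> 1")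
    case True
    then show ?thesis by (simp add: add_increasing2)
  next
    case False
    then have "\<bar>g z\<bar> powr 1 \<le> \<bar>g z\<bar> powr p"
      using assms(2) by (intro powr_mono) auto
    with False show ?thesis by simp
  qed
  ultimately show ?thesis
    using assms(1)
    by (rule_tac Bochner_Integration.integrable_bound[OF _ _ AE_I2, of _ "\<lambda>z. 1 + \<bar>g z\<bar> powr p"])
      (auto simp: Lp_def)
qed

lemma Lp_reflect:
  assumes "g \<in> Lp p (W \<times> {s<..T})" "open W" "0 \<le> p"
  shows "reflect W s T \<sigma> g \<in> Lp p UNIV"
proof -
  note sets = lebesgue_sets_cylinder[OF assms(2)]
  have Q: "(\<lambda>z. indicat_real (W \<times> {s<..T}) z * g z) \<in> Lp p UNIV"
    using assms(1) by (simp only: Lp_iff_indicator[OF sets(2)])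
  have "(\<lambda>z. indicat_real (W \<times> {s<..<T}) z * (indicat_real (W \<times> {s<..T}) z * g z)) \<in> Lp p UNIV"
    using Lp_mono[OF Q sets(1) assms(3)] by (simp only: Lp_iff_indicator[OF sets(1)])
  also have "(\<lambda>z. indicat_real (W \<times> {s<..<T}) z * (indicat_real (W \<times> {s<..T}) z * g z)) =
      (\<lambda>z. indicat_real (W \<times> {s<..<T}) z * g z)"
    by (auto simp: fun_eq_iff indicator_def)
  finally have U: "(\<lambda>z. indicat_real (W \<times> {s<..<T}) z * g z) \<in> Lp p UNIV" .
  show ?thesis
    unfolding reflect_def[abs_def]
    by (intro Lp_add Q Lp_cmult Lp_diag_affine[OF U] assms(3) time_reflection.nonsingular_diag_axioms)
qed

lemma axis_Basis_prod: "(axis k 1, 0) \<in> (Basis :: ((real ^ 'n) \<times> real) set)"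
  by (simp add: Basis_prod_def axis_in_Basis_iff)

lemma time_Basis_prod: "(0, 1) \<in> (Basis :: ((real ^ 'n) \<times> real) set)"
  by (simp add: Basis_prod_def)

lemma time_sign_simps: "time_sign (x, 0) = 1" "time_sign (x, 1) = - 1"
  by (simp_all add: time_sign_def)

lemma W21_reflect_cutoff:
  fixes W :: "(real ^ 'n) set" and u ut :: "(real ^ 'n) \<times> real \<Rightarrow> real"
    and s T p :: real
  defines "R \<equiv> reflect W s T 1"
  assumes W21: "W21_with p (W \<times> {s<..T}) u ut Du D2u"
    and W: "open W" "bounded W" and p: "1 \<le> p"
    and \<theta>: "test_function (W \<times> {s<..<2 * T - s}) \<theta>"
  shows "W21_with p UNIV (\<lambda>z. R u z * \<theta> z)
    (\<lambda>z. reflect W s T (- 1) ut z * \<theta> z + R u z * frechet_derivative \<theta> (at z) (0, 1))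
    (\<lambda>z. \<chi> k. R (\<lambda>z. Du z $ k) z * \<theta> z + R u z * frechet_derivative \<theta> (at z) (axis k 1, 0))
    (\<lambda>z. \<chi> k l. (R (\<lambda>z. D2u z $ k $ l) z * \<theta> z
        + R (\<lambda>z. Du z $ k) z * frechet_derivative \<theta> (at z) (axis l 1, 0))
      + (R (\<lambda>z. Du z $ l) z * frechet_derivative \<theta> (at z) (axis k 1, 0)
        + R u z * frechet_derivative (\<lambda>z. frechet_derivative \<theta> (at z) (axis k 1, 0)) (at z) (axis l 1, 0)))"
proof -
  let ?Q = "W \<times> {s<..T}" and ?D = "W \<times> {s<..<2 * T - s}"
  have Q: "?Q \<in> lmeasurable"
  proof (rule bounded_set_imp_lmeasurable)
    show "bounded ?Q" using W(2) by (intro bounded_Times) auto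
    show "?Q \<in> sets lebesgue" using W(1) by (rule lebesgue_sets_cylinder)
  qed
  have int: "interior ?Q = W \<times> {s<..<T}"
    using W(1) by (simp add: interior_Times interior_open)
  have D: "open ?D" using W(1) by (intro open_Times) auto
  have p0: "0 \<le> p" using p by simp
  note L = W21[unfolded W21_with_def int]
  note I = integrable_Lp[OF _ p Q]
  have Lu: "u \<in> Lp p ?Q" and Lut: "ut \<in> Lp p ?Q" and LDu: "(\<lambda>z. Du z $ k) \<in> Lp p ?Q"
    and LD2u: "(\<lambda>z. D2u z $ k $ l) \<in> Lp p ?Q" for k l
    using L by blast+
  have wt: "weak_deriv ?D (0, 1) (R u) (reflect W s T (- 1) ut)"
    using weak_deriv_reflect[OF _ W(1) time_Basis_prod I[OF Lu] I[OF Lut]] L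
    unfolding R_def time_sign_simps by blast
  have wx: "weak_deriv ?D (axis k 1, 0) (R u) (R (\<lambda>z. Du z $ k))" for k
    using weak_deriv_reflect[OF _ W(1) axis_Basis_prod I[OF Lu] I[OF LDu]] L
    unfolding R_def time_sign_simps by blast
  have wxx: "weak_deriv ?D (axis l 1, 0) (R (\<lambda>z. Du z $ k)) (R (\<lambda>z. D2u z $ k $ l))" for k l
    using weak_deriv_reflect[OF _ W(1) axis_Basis_prod I[OF LDu] I[OF LD2u]] L
    unfolding R_def time_sign_simps by blast
  have \<theta>k: "test_function ?D (\<lambda>z. frechet_derivative \<theta> (at z) (axis k 1, 0))" for k
    using \<theta> axis_Basis_prod by (rule test_function_deriv)
  have \<theta>kl: "test_function ?D (\<lambda>z. frechet_derivative (\<lambda>z. frechet_derivative \<theta> (at z) (axis k 1, 0))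
      (at z) (axis l 1, 0))" for k l
    using \<theta>k axis_Basis_prod by (rule test_function_deriv)
  have \<theta>t: "test_function ?D (\<lambda>z. frechet_derivative \<theta> (at z) (0, 1))"
    using \<theta> time_Basis_prod by (rule test_function_deriv)
  have Lmult: "(\<lambda>z. reflect W s T \<sigma> g z * \<eta> z) \<in> Lp p UNIV"
    if "g \<in> Lp p ?Q" "test_function ?D \<eta>" for g \<eta> \<sigma>
    using Lp_mult_test_function[OF Lp_reflect[OF that(1) W(1) p0] p0 that(2)] .
  show ?thesis
    unfolding W21_with_def interior_UNIV vec_lambda_beta
  proof (intro conjI allI)
    show "weak_deriv UNIV (0, 1) (\<lambda>z. R u z * \<theta> z)
        (\<lambda>z. reflect W s T (- 1) ut z * \<theta> z + R u z * frechet_derivative \<theta> (at z) (0, 1))"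
      using wt D time_Basis_prod \<theta> by (rule weak_deriv_mult)
    show "weak_deriv UNIV (axis k 1, 0) (\<lambda>z. R u z * \<theta> z)
        (\<lambda>z. R (\<lambda>z. Du z $ k) z * \<theta> z + R u z * frechet_derivative \<theta> (at z) (axis k 1, 0))" for k
      using wx D axis_Basis_prod \<theta> by (rule weak_deriv_mult)
    show "weak_deriv UNIV (axis l 1, 0)
        (\<lambda>z. R (\<lambda>z. Du z $ k) z * \<theta> z + R u z * frechet_derivative \<theta> (at z) (axis k 1, 0))
        (\<lambda>z. (R (\<lambda>z. D2u z $ k $ l) z * \<theta> z
        + R (\<lambda>z. Du z $ k) z * frechet_derivative \<theta> (at z) (axis l 1, 0))
      + (R (\<lambda>z. Du z $ l) z * frechet_derivative \<theta> (at z) (axis k 1, 0)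
        + R u z * frechet_derivative (\<lambda>z. frechet_derivative \<theta> (at z) (axis k 1, 0)) (at z) (axis l 1, 0)))"
      for k l
      by (intro weak_deriv_UNIV_add axis_Basis_prod weak_deriv_mult[OF wxx D axis_Basis_prod \<theta>]
          weak_deriv_mult[OF wx D axis_Basis_prod \<theta>k])
  qed (unfold R_def, (intro Lp_add p0 Lmult Lu Lut LDu LD2u \<theta> \<theta>k \<theta>kl \<theta>t)+)
qed

lemma frechet_derivative_locally_const:
  assumes "open U" "z \<in> U" "\<And>w. w \<in> U \<Longrightarrow> f w = c"
  shows "frechet_derivative f (at z) = (\<lambda>_. 0)"
proof (rule frechet_derivative_eqI)
  show "(f has_derivative (\<lambda>_. 0)) (at z)"
    by (rule has_derivative_transform_within_open[OF has_derivative_const[of c] assms(1,2)])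
      (simp add: assms(3))
qed

lemma pcompactly_in_ball:
  assumes "open \<Omega>" "0 < \<epsilon>" "ball x (2 * \<epsilon>) \<subseteq> \<Omega>" "0 < s"
  shows "pcompactly_in (ball x \<epsilon> \<times> {s<..T}) \<Omega> T"
  unfolding pcompactly_in_def
proof (intro conjI)
  have sub: "ball x \<epsilon> \<subseteq> \<Omega>"
    using assms(2,3) by (auto intro: order_trans[OF subset_ball])
  then show "ball x \<epsilon> \<times> {s<..T} \<subseteq> pcylinder \<Omega> T"
    using assms(4) by (auto simp: pcylinder_def)
  have "negligible {z :: (real ^ 'a) \<times> real. (0, 1) \<bullet> z = T}"
    by (rule negligible_hyperplane) (simp add: zero_prod_def)
  then show "negligible (ball x \<epsilon> \<times> {s<..T} - interior (ball x \<epsilon> \<times> {s<..T}))"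
    by (rule negligible_subset) (auto simp: interior_Times inner_prod_def)
  have "ereal (min \<epsilon> (sqrt s)) \<le> ereal (pdist z w)"
    if z: "z \<in> ball x \<epsilon> \<times> {s<..T}" and w: "w \<in> pboundary \<Omega> T" for z w
  proof -
    from w consider "snd w = 0" | "fst w \<in> frontier \<Omega>"
      by (auto simp: pboundary_def)
    then have "min \<epsilon> (sqrt s) \<le> pdist z w"
    proof cases
      case 1
      then have "s \<le> (norm (fst z - fst w))\<^sup>2 + \<bar>snd z - snd w\<bar>"
        using z by (auto simp: add_increasing)
      then have "sqrt s \<le> pdist z w"
        unfolding pdist_def by (rule real_sqrt_le_mono)
      then show ?thesis by simp
    next
      case 2
      then have "fst w \<notin> ball x (2 * \<epsilon>)"
        using assms(1,3) by (auto simp: frontier_def interior_open)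
      then have "2 * \<epsilon> \<le> dist x (fst w)" by simp
      also have "\<dots> \<le> dist x (fst z) + dist (fst z) (fst w)" by (rule dist_triangle)
      finally have "\<epsilon> \<le> norm (fst z - fst w)"
        using z by (auto simp: dist_norm)
      then have "\<epsilon>\<^sup>2 \<le> (norm (fst z - fst w))\<^sup>2 + \<bar>snd z - snd w\<bar>"
        using assms(2) by (intro add_increasing2 power_mono) auto
      then have "\<epsilon> \<le> pdist z w"
        unfolding pdist_def by (rule real_le_rsqrt)
      then show ?thesis by simp
    qed
    then show ?thesis by (simp only: ereal_less_eq)
  qed
  then have "ereal (min \<epsilon> (sqrt s)) \<le> pset_dist (ball x \<epsilon> \<times> {s<..T}) (pboundary \<Omega> T)"
    unfolding pset_dist_def by (intro INF_greatest)
  moreover have "0 < ereal (min \<epsilon> (sqrt s))"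
    using assms(2,4) by simp
  ultimately show "0 < pset_dist (ball x \<epsilon> \<times> {s<..T}) (pboundary \<Omega> T)"
    by (rule less_le_trans[rotated])
qed

text \<open>Test functions only matter near the touching point, so they may be replaced by globally
  defined ones; derivatives agree pointwise, not just almost everywhere.\<close>

lemma W21_loc_extension:
  fixes \<phi> :: "(real ^ 'n) \<times> real \<Rightarrow> real"
  assumes "open \<Omega>" "1 \<le> p" and cont: "continuous_on (pcylinder \<Omega> T) \<phi>"
    and W21: "W21_loc_with p \<Omega> T \<phi> \<phi>t D\<phi> D2\<phi>" and z: "z \<in> pcylinder \<Omega> T"
  obtains \<Phi> \<Phi>t D\<Phi> D2\<Phi> \<delta> where "continuous_on UNIV \<Phi>" "W21_with p UNIV \<Phi> \<Phi>t D\<Phi> D2\<Phi>" "0 < \<delta>"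
    "\<And>w. dist w z < \<delta> \<Longrightarrow> snd w \<le> T \<Longrightarrow>
      \<Phi> w = \<phi> w \<and> \<Phi>t w = \<phi>t w \<and> D\<Phi> w = D\<phi> w \<and> D2\<Phi> w = D2\<phi> w"
proof -
  define s where "s = snd z / 2"
  have s: "0 < s" "s < T" "s < snd z" "snd z \<le> T"
    using z by (auto simp: s_def pcylinder_def)
  obtain \<epsilon>0 where "0 < \<epsilon>0" "ball (fst z) \<epsilon>0 \<subseteq> \<Omega>"
  proof (rule openE[OF \<open>open \<Omega>\<close>])
    show "fst z \<in> \<Omega>" using z by (auto simp: pcylinder_def)
  qed
  define \<epsilon> where "\<epsilon> = \<epsilon>0 / 2"
  have \<epsilon>: "0 < \<epsilon>" "ball (fst z) (2 * \<epsilon>) \<subseteq> \<Omega>"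
    using \<open>0 < \<epsilon>0\<close> \<open>ball (fst z) \<epsilon>0 \<subseteq> \<Omega>\<close> by (simp_all add: \<epsilon>_def)
  define W where "W = ball (fst z) \<epsilon>"
  have W: "open W" "bounded W" by (simp_all add: W_def)
  have pc: "pcompactly_in (W \<times> {s<..T}) \<Omega> T"
    unfolding W_def using \<open>open \<Omega>\<close> \<epsilon> s(1) by (rule pcompactly_in_ball)
  let ?D = "W \<times> {s<..<2 * T - s}"
  have D: "open ?D" "z \<in> ?D"
    using W s \<epsilon> by (auto intro!: open_Times simp: W_def mem_Times_iff)
  obtain \<theta> \<delta> where \<theta>: "test_function ?D \<theta>" "0 < \<delta>" "\<And>w. dist w z < \<delta> \<Longrightarrow> \<theta> w = 1"
    using test_function_cutoff[OF D] by blast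
  have \<theta>': "\<theta> w = 1" if "w \<in> ball z \<delta>" for w
    using that \<theta>(3) by (simp add: dist_commute)
  have d\<theta>: "frechet_derivative \<theta> (at w) = (\<lambda>_. 0)" if "w \<in> ball z \<delta>" for w
    using frechet_derivative_locally_const[OF open_ball that, of \<theta> 1] \<theta>' by blast
  have d2\<theta>: "frechet_derivative (\<lambda>w. frechet_derivative \<theta> (at w) b) (at w) = (\<lambda>_. 0)"
    if "w \<in> ball z \<delta>" for w b
    using frechet_derivative_locally_const[OF open_ball that, of "\<lambda>w. frechet_derivative \<theta> (at w) b" 0] d\<theta>
    by simp
  have W21': "W21_with p (W \<times> {s<..T}) \<phi> \<phi>t D\<phi> D2\<phi>"
    using W21 pc by (simp add: W21_loc_with_def)
  note ext = W21_reflect_cutoff[OF W21' W \<open>1 \<le> p\<close> \<theta>(1)]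
  have refl: "reflect W s T \<sigma> g w = g w" if "w \<in> ball z \<delta>" "snd w \<le> T" for \<sigma> g w
  proof -
    have "w \<in> ?D"
      using \<theta>'[OF that(1)] test_function_zero[OF \<theta>(1), of w] by fastforce
    with that(2) show ?thesis
      by (auto simp: reflect_def time_reflection_eq indicator_def)
  qed
  have "continuous_on UNIV (\<lambda>w. reflect W s T 1 \<phi> w * \<theta> w)"
  proof -
    obtain K where K: "compact K" "K \<subseteq> ?D" "\<And>w. w \<notin> K \<Longrightarrow> \<theta> w = 0"
      using \<theta>(1) unfolding test_function_def by blast
    have "continuous_on ?D (\<lambda>w. \<phi> (fst w, min (snd w) (2 * T - snd w)))"
    proof (rule continuous_on_compose2[OF cont])
      show "(\<lambda>w. (fst w, min (snd w) (2 * T - snd w))) ` ?D \<subseteq> pcylinder \<Omega> T"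
        using \<epsilon> s(1) by (auto simp: pcylinder_def W_def min_def)
    qed (intro continuous_intros)
    moreover have "reflect W s T 1 \<phi> w = \<phi> (fst w, min (snd w) (2 * T - snd w))" if "w \<in> ?D" for w
      using that by (auto simp: reflect_def time_reflection_eq indicator_def min_def)
    ultimately have "continuous_on ?D (reflect W s T 1 \<phi>)"
      by (simp cong: continuous_on_cong_simp)
    then have "continuous_on ?D (\<lambda>w. reflect W s T 1 \<phi> w * \<theta> w)"
      using test_function_continuous[OF \<theta>(1)]
      by (intro continuous_on_mult) (auto intro: continuous_on_subset)
    moreover have "continuous_on (- K) (\<lambda>w. reflect W s T 1 \<phi> w * \<theta> w)"
      using K(3) by (intro continuous_on_eq[OF continuous_on_const[of _ 0]]) auto
    ultimately have "continuous_on (?D \<union> - K) (\<lambda>w. reflect W s T 1 \<phi> w * \<theta> w)"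
      using D(1) compact_imp_closed[OF K(1)] by (intro continuous_on_open_Un) auto
    also have "?D \<union> - K = UNIV" using K(2) by blast
    finally show ?thesis .
  qed
  from that[OF this ext \<theta>(2)] show thesis
    using \<theta>' d\<theta> d2\<theta> refl by (simp add: dist_commute vec_eq_iff)
qed

lemma W21_loc_restrict:
  assumes "W21_with p UNIV u ut Du D2u" "0 \<le> p"
  shows "W21_loc_with p \<Omega> T u ut Du D2u"
  unfolding W21_loc_with_def
proof (intro allI impI)
  fix Q assume "pcompactly_in Q \<Omega> T"
  then have "negligible (Q - interior Q)" by (simp add: pcompactly_in_def)
  then have "interior Q \<union> (Q - interior Q) \<in> sets lebesgue"
    by (intro sets.Un) (auto simp: negligible_iff_null_sets)
  also have "interior Q \<union> (Q - interior Q) = Q" using interior_subset by blast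
  finally have Q: "Q \<in> sets lebesgue" .
  show "W21_with p Q u ut Du D2u"
    using assms(1) Lp_mono[OF _ Q assms(2)] weak_deriv_restrict[OF _ open_interior]
    unfolding W21_with_def interior_UNIV by blast
qed

section \<open>Parabolic rescaling\<close>

definition pscale :: "real \<Rightarrow> (real ^ 'n) \<times> real \<Rightarrow> (real ^ 'n) \<times> real \<Rightarrow> (real ^ 'n) \<times> real" where
  "pscale r a z = (fst a + r *\<^sub>R fst z, snd a + r\<^sup>2 * snd z)"

definition pweight :: "real \<Rightarrow> (real ^ 'n) \<times> real \<Rightarrow> real" where
  "pweight r j = (if snd j = 0 then r else r\<^sup>2)"

lemma pscale_eq: "pscale r a = diag_affine (pweight r) a"
  for a :: "(real ^ 'n) \<times> real"
proof (rule ext, rule euclidean_eqI)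
  fix z j :: "(real ^ 'n) \<times> real" assume "j \<in> Basis"
  then show "pscale r a z \<bullet> j = diag_affine (pweight r) a z \<bullet> j"
    unfolding inner_diag_affine[OF \<open>j \<in> Basis\<close>]
    by (auto simp: Basis_prod_def pweight_def inner_prod_def pscale_def inner_add_left)
qed

lemma nonsingular_pweight: "r \<noteq> 0 \<Longrightarrow> nonsingular_diag (pweight r)"
  by unfold_locales (simp add: pweight_def)

lemma pweight_jacobian:
  assumes "0 < r"
  shows "nonsingular_diag.J (pweight r :: (real ^ 'n) \<times> real \<Rightarrow> real) = r ^ (CARD('n) + 2)"
proof -
  interpret nonsingular_diag "pweight r :: (real ^ 'n) \<times> real \<Rightarrow> real" 0
    using assms by (intro nonsingular_pweight) simp
  have inj: "inj_on (\<lambda>u. (u, 0 :: real)) (Basis :: (real ^ 'n) set)"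
    by (auto intro: inj_onI)
  have "J = (\<Prod>j\<in>(\<lambda>u. (u, 0)) ` (Basis :: (real ^ 'n) set). \<bar>pweight r j\<bar>) * (\<Prod>j\<in>(\<lambda>v. (0 :: real ^ 'n, v)) ` Basis. \<bar>pweight r j\<bar>)"
    unfolding J_def Basis_prod_def by (rule prod.union_disjoint) auto
  also have "\<dots> = r ^ CARD('n) * r\<^sup>2"
    using assms by (simp add: prod.reindex[OF inj] pweight_def)
  finally show ?thesis by (simp add: power_add power2_eq_square)
qed

lemma pscale_inverse:
  assumes "r \<noteq> 0"
  shows "pscale (1 / r) (- (1 / r) *\<^sub>R fst a, - (snd a / r\<^sup>2)) (pscale r a z) = z"
    "pscale r a (pscale (1 / r) (- (1 / r) *\<^sub>R fst a, - (snd a / r\<^sup>2)) z) = z"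
  using assms by (simp_all add: pscale_def prod_eq_iff scaleR_add_right field_simps)

lemma W21_pscale:
  assumes W21: "W21_with p UNIV u ut Du D2u" and "r \<noteq> 0" "0 \<le> p"
  shows "W21_with p UNIV (\<lambda>z. k * u (pscale r a z)) (\<lambda>z. k * r\<^sup>2 * ut (pscale r a z))
    (\<lambda>z. (k * r) *\<^sub>R Du (pscale r a z)) (\<lambda>z. (k * r\<^sup>2) *\<^sub>R D2u (pscale r a z))"
proof -
  note ns = nonsingular_pweight[OF \<open>r \<noteq> 0\<close>]
  note L = W21[unfolded W21_with_def interior_UNIV]
  have Lp: "(\<lambda>z. c * g (pscale r a z)) \<in> Lp p UNIV" if "g \<in> Lp p UNIV" for c g
    unfolding pscale_eq by (intro Lp_cmult Lp_diag_affine that ns \<open>0 \<le> p\<close>)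
  have wd: "weak_deriv UNIV b (\<lambda>z. c * g (pscale r a z)) (\<lambda>z. c * pweight r b * h (pscale r a z))"
    if "weak_deriv UNIV b g h" "b \<in> Basis" for b c g h
    using weak_deriv_UNIV_cmult[OF weak_deriv_UNIV_diag_affine[OF that ns]]
    unfolding pscale_eq by (simp add: mult.assoc)
  have wt: "pweight r (0, 1) = r\<^sup>2" "pweight r (axis i 1, 0) = r" for i
    by (simp_all add: pweight_def)
  show ?thesis
    unfolding W21_with_def interior_UNIV
  proof (intro conjI allI)
    show "weak_deriv UNIV (0, 1) (\<lambda>z. k * u (pscale r a z)) (\<lambda>z. k * r\<^sup>2 * ut (pscale r a z))"
      using wd[OF _ time_Basis_prod, of u ut k] L by (simp add: wt)
    show "weak_deriv UNIV (axis i 1, 0) (\<lambda>z. k * u (pscale r a z))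
        (\<lambda>z. ((k * r) *\<^sub>R Du (pscale r a z)) $ i)" for i
      using wd[OF _ axis_Basis_prod[of i], of u "\<lambda>z. Du z $ i" k] L by (simp add: wt)
    show "weak_deriv UNIV (axis l 1, 0) (\<lambda>z. ((k * r) *\<^sub>R Du (pscale r a z)) $ i)
        (\<lambda>z. ((k * r\<^sup>2) *\<^sub>R D2u (pscale r a z)) $ i $ l)" for i l
      using wd[OF _ axis_Basis_prod[of l], of "\<lambda>z. Du z $ i" "\<lambda>z. D2u z $ i $ l" "k * r"] L
      by (simp add: wt power2_eq_square mult.assoc)
    show "(\<lambda>z. ((k * r) *\<^sub>R Du (pscale r a z)) $ i) \<in> Lp p UNIV" for i
      using Lp[of "\<lambda>z. Du z $ i" "k * r"] L by simp
    show "(\<lambda>z. ((k * r\<^sup>2) *\<^sub>R D2u (pscale r a z)) $ i $ l) \<in> Lp p UNIV" for i l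
      using Lp[of "\<lambda>z. D2u z $ i $ l" "k * r\<^sup>2"] L by simp
  qed (use L Lp in simp_all)
qed

lemma open_cube: "open (cube r :: (real ^ 'n) set)"
proof -
  have "cube r = (\<Inter>i. {x :: real ^ 'n. - r < x $ i} \<inter> {x. x $ i < r})"
    by (auto simp: cube_def)
  then show ?thesis
    by (auto intro!: open_INT open_Int open_Collect_less continuous_intros)
qed

lemma Qr_iff: "w \<in> Qr e z \<longleftrightarrow> fst w - fst z \<in> cube e \<and> snd w - snd z \<in> {- e\<^sup>2<..0}"
proof
  assume "fst w - fst z \<in> cube e \<and> snd w - snd z \<in> {- e\<^sup>2<..0}"
  then show "w \<in> Qr e z"
    unfolding Qr_def by (intro CollectI exI[of _ "fst w - fst z"] exI[of _ "snd w - snd z"]) auto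
qed (auto simp: Qr_def)

lemma Qr_sets: "Qr e z \<in> sets lebesgue"
proof -
  have "Qr e z = (\<lambda>x. x - fst z) -` cube e \<times> {snd z - e\<^sup>2<..snd z}"
    by (auto simp: Qr_iff mem_Times_iff)
  moreover have "open ((\<lambda>x. x - fst z) -` cube e)"
    by (intro open_vimage open_cube continuous_intros)
  ultimately show ?thesis
    by (simp add: lebesgue_sets_cylinder)
qed

lemma cube_mono:
  assumes "e \<le> e'"
  shows "cube e \<subseteq> cube e'"
proof
  fix x assume "x \<in> cube e"
  then have "- e < x $ i" "x $ i < e" for i by (auto simp: cube_def)
  then have "- e' < x $ i \<and> x $ i < e'" for i using assms by (smt (verit))
  then show "x \<in> cube e'" by (simp add: cube_def)
qed

lemma Qr_mono:
  assumes "0 \<le> e" "e \<le> e'"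
  shows "Qr e z \<subseteq> Qr e' z"
proof
  fix w assume "w \<in> Qr e z"
  moreover have "e\<^sup>2 \<le> e'\<^sup>2" using assms by (intro power_mono) auto
  ultimately show "w \<in> Qr e' z"
    using cube_mono[OF assms(2)] by (auto simp: Qr_iff)
qed

lemma cube_scaleR:
  assumes "0 < r"
  shows "r *\<^sub>R x \<in> cube (r * e) \<longleftrightarrow> x \<in> cube e"
proof -
  have "- (r * e) < r * t \<and> r * t < r * e \<longleftrightarrow> - e < t \<and> t < e" for t
    unfolding mult_minus_right[symmetric] using assms by (simp only: mult_less_cancel_left_pos)
  then show ?thesis by (simp add: cube_def)
qed

lemma Qr_pscale:
  assumes "0 < r"
  shows "pscale r a w \<in> Qr (r * e) (pscale r a z) \<longleftrightarrow> w \<in> Qr e z"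
proof -
  have "fst (pscale r a w) - fst (pscale r a z) = r *\<^sub>R (fst w - fst z)"
    by (simp add: pscale_def scaleR_diff_right)
  moreover have "snd (pscale r a w) - snd (pscale r a z) = r\<^sup>2 * (snd w - snd z)"
    by (simp add: pscale_def right_diff_distrib)
  moreover have "r\<^sup>2 * t \<in> {- (r * e)\<^sup>2<..0} \<longleftrightarrow> t \<in> {- e\<^sup>2<..0}" for t
  proof -
    have "- (r * e)\<^sup>2 = r\<^sup>2 * - e\<^sup>2" by (simp add: power_mult_distrib)
    moreover have "0 < r\<^sup>2" using assms by simp
    ultimately show ?thesis
      by (simp only: greaterThanAtMost_iff mult_less_cancel_left_pos mult_le_0_iff) auto
  qed
  ultimately show ?thesis
    using assms by (simp only: Qr_iff cube_scaleR)
qed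

lemma Qr_subset_ball:
  fixes z :: "(real ^ 'n) \<times> real"
  assumes "0 < \<delta>"
  obtains e where "0 < e" "Qr e z \<subseteq> ball z \<delta>"
proof -
  define N where "N = real CARD('n) + 1"
  define e where "e = min 1 (\<delta> / (2 * N))"
  have N: "0 < N" by (simp add: N_def)
  then have e: "0 < e" "e \<le> 1" "N * e < \<delta>"
    using assms by (auto simp: e_def min_def field_simps)
  have "w \<in> ball z \<delta>" if "w \<in> Qr e z" for w
  proof -
    have "\<bar>(fst w - fst z) $ i\<bar> \<le> e" for i
    proof -
      have "- e < (fst w - fst z) $ i \<and> (fst w - fst z) $ i < e"
        using that unfolding Qr_iff cube_def by blast
      then show ?thesis by linarith
    qed
    then have "norm (fst w - fst z) \<le> real CARD('n) * e"
      using norm_le_l1_cart[of "fst w - fst z"] sum_bounded_above[of UNIV "\<lambda>i. \<bar>(fst w - fst z) $ i\<bar>" e]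
      by (auto intro: order_trans)
    moreover have "\<bar>snd w - snd z\<bar> \<le> e"
    proof -
      have "e\<^sup>2 \<le> e" using e by (simp add: power2_eq_square mult_left_le)
      with that show ?thesis by (auto simp: Qr_iff)
    qed
    moreover have "dist z w \<le> norm (fst w - fst z) + \<bar>snd w - snd z\<bar>"
      using norm_Pair_le[of "fst w - fst z" "snd w - snd z"]
      by (simp add: dist_norm norm_minus_commute flip: fst_diff snd_diff)
    ultimately have "dist z w \<le> N * e"
      by (simp add: N_def algebra_simps)
    with e show ?thesis by simp
  qed
  with e that show thesis by blast
qed

lemma esssup_cong:
  assumes "\<And>x. x \<in> space M \<Longrightarrow> f x = g x"
  shows "esssup M f = esssup M g"
proof (cases "f \<in> borel_measurable M")
  case True
  moreover from this have "g \<in> borel_measurable M"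
    using measurable_cong[of M f g, OF assms] by blast
  ultimately show ?thesis
    using assms by (intro esssup_AE_cong AE_I2)
next
  case False
  moreover from this have "g \<notin> borel_measurable M"
    using measurable_cong[of M f g, OF assms] by blast
  ultimately show ?thesis
    by (simp add: esssup_non_measurable)
qed

lemma ess_inf_on_pscale:
  fixes z :: "(real ^ 'n) \<times> real"
  assumes "0 < r" "0 < k" "\<And>w. w \<in> Qr e z \<Longrightarrow> g (pscale r a w) = - (k * h w)"
  shows "ess_inf_on (Qr (r * e) (pscale r a z)) g = - (ereal k * ess_sup_on (Qr e z) h)"
proof -
  interpret nonsingular_diag "pweight r" a
    using assms(1) by (intro nonsingular_pweight) simp
  have v: "diag_affine (pweight r) a -` Qr (r * e) (pscale r a z) = Qr e z"
    unfolding pscale_eq[symmetric] vimage_def Qr_pscale[OF assms(1)] by simp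
  have "esssup (lebesgue_on (Qr (r * e) (pscale r a z))) (\<lambda>w. - ereal (g w)) =
      esssup (lebesgue_on (Qr e z)) (\<lambda>w. - ereal (g (pscale r a w)))"
    using esssup_comp[OF Qr_sets, of "r * e" "pscale r a z" "\<lambda>w. - ereal (g w)"]
    unfolding v by (simp add: pscale_eq)
  also have "\<dots> = esssup (lebesgue_on (Qr e z)) (\<lambda>w. ereal k * ereal (h w))"
    by (intro esssup_cong) (simp add: assms(3))
  also have "\<dots> = ereal k * esssup (lebesgue_on (Qr e z)) (\<lambda>w. ereal (h w))"
    by (rule esssup_cmult[OF assms(2)])
  finally show ?thesis
    by (simp only: ess_inf_on_def ess_sup_on_def)
qed

lemma Lp_visc_supersol_rescale:
  fixes v :: "(real ^ 'n) \<times> real \<Rightarrow> real"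
  assumes "open \<Omega>'" "1 \<le> p" "0 < r" "0 < c"
    and sub: "Lp_visc_subsol p F \<Omega> T v"
    and P: "pscale r a ` pcylinder \<Omega>' T' \<subseteq> pcylinder \<Omega> T"
  shows "Lp_visc_supersol p
    (\<lambda>z \<xi> X. - (r\<^sup>2 / c) * F (pscale r a z) (- (c / r) *\<^sub>R \<xi>) (- (c / r\<^sup>2) *\<^sub>R X)) \<Omega>' T'
    (\<lambda>z. (m - v (pscale r a z)) / c)"
  unfolding Lp_visc_supersol_def
proof (intro conjI allI impI ballI, goal_cases)
  case 1
  have "continuous_on (pcylinder \<Omega> T) v"
    using sub by (simp add: Lp_visc_subsol_def)
  then have "continuous_on (pcylinder \<Omega>' T') (\<lambda>z. v (pscale r a z))"
  proof (rule continuous_on_compose2)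
    show "continuous_on (pcylinder \<Omega>' T') (pscale r a)"
      unfolding pscale_def[abs_def] by (intro continuous_intros)
  qed (rule P)
  then show ?case
    using assms(4) by (intro continuous_intros) auto
next
  case (2 \<phi> \<phi>t D\<phi> D2\<phi> z)
  let ?P = "pscale r a"
  let ?G = "\<lambda>w. \<phi>t w + - (r\<^sup>2 / c) * F (?P w) (- (c / r) *\<^sub>R D\<phi> w) (- (c / r\<^sup>2) *\<^sub>R D2\<phi> w)"
  have r0: "r \<noteq> 0" using assms(3) by simp
  obtain r' where r': "0 < r'" "Qr r' z \<subseteq> pcylinder \<Omega>' T'"
      "\<And>w. w \<in> Qr r' z \<Longrightarrow> (m - v (?P z)) / c - \<phi> z \<le> (m - v (?P w)) / c - \<phi> w"
    using 2(4) by blast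
  obtain \<Phi> \<Phi>t D\<Phi> D2\<Phi> \<delta> where \<Phi>: "continuous_on UNIV \<Phi>" "W21_with p UNIV \<Phi> \<Phi>t D\<Phi> D2\<Phi>" "0 < \<delta>"
    "\<And>w. dist w z < \<delta> \<Longrightarrow> snd w \<le> T' \<Longrightarrow>
      \<Phi> w = \<phi> w \<and> \<Phi>t w = \<phi>t w \<and> D\<Phi> w = D\<phi> w \<and> D2\<Phi> w = D2\<phi> w"
    using W21_loc_extension[OF assms(1,2) 2(1-3)] by blast
  obtain e0 where e0: "0 < e0" "Qr e0 z \<subseteq> ball z \<delta>"
    using Qr_subset_ball[OF \<Phi>(3)] by blast
  define e1 where "e1 = min e0 r'"
  have e1: "0 < e1" "Qr e1 z \<subseteq> Qr e0 z" "Qr e1 z \<subseteq> Qr r' z"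
    using e0(1) r'(1) by (simp_all add: e1_def Qr_mono)
  have eq: "\<Phi> w = \<phi> w" "\<Phi>t w = \<phi>t w" "D\<Phi> w = D\<phi> w" "D2\<Phi> w = D2\<phi> w" if "w \<in> Qr e1 z" for w
  proof -
    have "dist w z < \<delta>" using that e0(2) e1(2) by (auto simp: dist_commute)
    moreover have "snd w \<le> T'" using that e1(3) r'(2) by (auto simp: pcylinder_def)
    ultimately show "\<Phi> w = \<phi> w" "\<Phi>t w = \<phi>t w" "D\<Phi> w = D\<phi> w" "D2\<Phi> w = D2\<phi> w"
      using \<Phi>(4)[of w] by blast+
  qed
  define a' where "a' = (- (1 / r) *\<^sub>R fst a, - (snd a / r\<^sup>2))"
  let ?S = "pscale (1 / r) a'"
  note inv = pscale_inverse[OF r0, of a, folded a'_def]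
  define \<psi> where "\<psi> w = - c * \<Phi> (?S w)" for w
  define \<psi>t where "\<psi>t w = - c * (1 / r)\<^sup>2 * \<Phi>t (?S w)" for w
  define D\<psi> where "D\<psi> w = (- c * (1 / r)) *\<^sub>R D\<Phi> (?S w)" for w
  define D2\<psi> where "D2\<psi> w = (- c * (1 / r)\<^sup>2) *\<^sub>R D2\<Phi> (?S w)" for w
  have "W21_with p UNIV \<psi> \<psi>t D\<psi> D2\<psi>"
    unfolding \<psi>_def \<psi>t_def D\<psi>_def D2\<psi>_def using \<Phi>(2) r0 assms(2) by (intro W21_pscale) auto
  then have W21\<psi>: "W21_loc_with p \<Omega> T \<psi> \<psi>t D\<psi> D2\<psi>"
    using assms(2) by (intro W21_loc_restrict) auto
  have cont\<psi>: "continuous_on (pcylinder \<Omega> T) \<psi>"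
    unfolding \<psi>_def pscale_def
    by (intro continuous_intros continuous_on_compose2[OF \<Phi>(1)]) auto
  have zP: "?P z \<in> pcylinder \<Omega> T" using P 2(3) by blast
  have vim: "w \<in> ?P ` Qr e z" if "w \<in> Qr (r * e) (?P z)" for w e
    using that Qr_pscale[OF assms(3), of a "?S w" e z] inv(2)[of w] by (metis imageI)
  have touch: "\<exists>\<rho>>0. Qr \<rho> (?P z) \<subseteq> pcylinder \<Omega> T \<and> (\<forall>w\<in>Qr \<rho> (?P z). v w - \<psi> w \<le> v (?P z) - \<psi> (?P z))"
  proof (intro exI[of _ "r * e1"] conjI ballI subsetI)
    show "0 < r * e1" using assms(3) e1(1) by simp
    fix w assume "w \<in> Qr (r * e1) (?P z)"
    then obtain y where y: "w = ?P y" "y \<in> Qr e1 z" using vim by blast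
    show "w \<in> pcylinder \<Omega> T"
      using y e1(3) r'(2) P by blast
    have z1: "z \<in> Qr e1 z"
      using e1(1) by (simp add: Qr_iff cube_def)
    have "\<psi> w = - c * \<phi> y" "\<psi> (?P z) = - c * \<phi> z"
      using eq(1)[OF y(2)] eq(1)[OF z1] by (simp_all add: \<psi>_def y inv)
    moreover have "(m - v (?P z)) / c - \<phi> z \<le> (m - v (?P y)) / c - \<phi> y"
      using r'(3) y(2) e1(3) by blast
    then have le: "c * ((m - v (?P z)) / c - \<phi> z) \<le> c * ((m - v (?P y)) / c - \<phi> y)"
      using assms(4) by (intro mult_left_mono) auto
    have cancel: "c * ((m - x) / c - y) = m - x - c * y" for x y
      using assms(4) by (simp add: field_simps)
    have "m - v (?P z) - c * \<phi> z \<le> m - v (?P y) - c * \<phi> y"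
      using le unfolding cancel .
    ultimately show "v w - \<psi> w \<le> v (?P z) - \<psi> (?P z)"
      by (simp add: y(1))
  qed
  obtain l where l: "((\<lambda>\<epsilon>. ess_inf_on (Qr \<epsilon> (?P z)) (\<lambda>w. \<psi>t w + F w (D\<psi> w) (D2\<psi> w))) \<longlongrightarrow> l) (at_right 0)"
      "l \<le> 0"
    using sub cont\<psi> W21\<psi> zP touch unfolding Lp_visc_subsol_def by meson
  let ?k = "c / r\<^sup>2"
  have k: "0 < ?k" using assms(3,4) by simp
  have ess: "ess_inf_on (Qr (r * e) (?P z)) (\<lambda>w. \<psi>t w + F w (D\<psi> w) (D2\<psi> w)) =
      - (ereal ?k * ess_sup_on (Qr e z) ?G)" if "0 < e" "e \<le> e1" for e
  proof (rule ess_inf_on_pscale[OF assms(3) k])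
    fix w assume "w \<in> Qr e z"
    then have w: "w \<in> Qr e1 z" using Qr_mono that by (meson less_imp_le subsetD)
    have "- (?k * ?G w) = - (c / r\<^sup>2) * \<phi>t w + F (?P w) (- (c / r) *\<^sub>R D\<phi> w) (- (c / r\<^sup>2) *\<^sub>R D2\<phi> w)"
      using assms(3,4) by (simp add: field_simps)
    then show "\<psi>t (?P w) + F (?P w) (D\<psi> (?P w)) (D2\<psi> (?P w)) = - (?k * ?G w)"
      by (simp add: \<psi>t_def D\<psi>_def D2\<psi>_def inv eq[OF w] power_divide)
  qed
  have "filterlim (\<lambda>e. r * e) (at_right 0) (at_right 0)"
    using assms(3) by (auto simp: filterlim_at eventually_at_right_field mult_pos_pos
        intro!: tendsto_eq_intros exI[of _ 1])
  from filterlim_compose[OF l(1) this]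
  have "((\<lambda>e. - (ereal ?k * ess_sup_on (Qr e z) ?G)) \<longlongrightarrow> l) (at_right 0)"
  proof (rule Lim_transform_eventually)
    show "\<forall>\<^sub>F e in at_right 0. ess_inf_on (Qr (r * e) (?P z)) (\<lambda>w. \<psi>t w + F w (D\<psi> w) (D2\<psi> w)) =
      - (ereal ?k * ess_sup_on (Qr e z) ?G)"
      using e1(1) ess by (auto simp: eventually_at_right_field intro!: exI[of _ e1])
  qed
  then have "((\<lambda>e. ereal ?k * ess_sup_on (Qr e z) ?G) \<longlongrightarrow> - l) (at_right 0)"
    using tendsto_uminus_ereal by fastforce
  then have "((\<lambda>e. ereal (1 / ?k) * (ereal ?k * ess_sup_on (Qr e z) ?G)) \<longlongrightarrow> ereal (1 / ?k) * - l) (at_right 0)"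
    by (intro tendsto_cmult_ereal) auto
  moreover have "ereal (1 / ?k) * (ereal ?k * x) = x" for x
    using assms(3,4) by (cases x) auto
  moreover have "0 \<le> ereal (1 / ?k) * - l"
    using assms(3,4) l(2) by (intro ereal_0_le_mult) (simp_all add: ereal_0_le_uminus_iff)
  ultimately show ?case by auto
qed

section \<open>Pucci operators\<close>

lemma mat_vector_mult: "mat k *v \<xi> = k *\<^sub>R (\<xi> :: real ^ 'n)"
  by (simp add: vec_eq_iff matrix_vector_mult_def mat_def if_distrib if_distribR cong: if_cong)

lemma quadratic_form_axis:
  fixes A :: "real ^ 'n ^ 'n"
  assumes "transpose A = A"
  shows "(axis i 1 + c *\<^sub>R axis j 1) \<bullet> (A *v (axis i 1 + c *\<^sub>R axis j 1)) =
    A $ i $ i + 2 * c * A $ i $ j + c\<^sup>2 * A $ j $ j"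
proof -
  have ax: "axis k 1 \<bullet> (A *v axis l 1) = A $ k $ l" for k l
    by (simp add: inner_axis' matrix_vector_mul_component inner_axis)
  have "A $ j $ i = A $ i $ j"
    using assms by (metis transpose_def vec_lambda_beta)
  then show ?thesis
    by (simp add: matrix_vector_right_distrib inner_add_left inner_add_right ax
        matrix_vector_mult_scaleR power2_eq_square algebra_simps)
qed

lemma elliptic_matrices_entry_bound:
  assumes A: "A \<in> elliptic_matrices lam Lam" and "0 < lam"
  shows "\<bar>A $ i $ j\<bar> \<le> Lam"
proof -
  have sym: "transpose A = A"
    and q: "\<And>\<xi>. lam * (\<xi> \<bullet> \<xi>) \<le> \<xi> \<bullet> (A *v \<xi>)" "\<And>\<xi>. \<xi> \<bullet> (A *v \<xi>) \<le> Lam * (\<xi> \<bullet> \<xi>)"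
    using A by (simp_all add: elliptic_matrices_def mat_le_def mat_vector_mult)
  have diag: "lam \<le> A $ k $ k" "A $ k $ k \<le> Lam" for k
    using quadratic_form_axis[OF sym, of k 0 k] q[of "axis k 1"] by (simp_all add: inner_axis_axis)
  show ?thesis
  proof (cases "i = j")
    case True
    with diag[of j] assms(2) show ?thesis by auto
  next
    case False
    then have "(axis i 1 + c *\<^sub>R axis j 1) \<bullet> (axis i 1 + c *\<^sub>R axis j 1 :: real ^ 'a) = 1 + c\<^sup>2" for c
      by (simp add: inner_add_left inner_add_right inner_axis_axis power2_eq_square)
    then have "A $ i $ i + 2 * c * A $ i $ j + c\<^sup>2 * A $ j $ j \<le> Lam * (1 + c\<^sup>2)" for c
      using q(2)[of "axis i 1 + c *\<^sub>R axis j 1"] quadratic_form_axis[OF sym, of i c j] by simp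
    from this[of 1] this[of "-1"] diag(1)[of i] diag(1)[of j] assms(2) show ?thesis
      by auto
  qed
qed

lemma bdd_above_trace:
  fixes X :: "real ^ 'n ^ 'n"
  assumes "0 < lam"
  shows "bdd_above ((\<lambda>A. - trace (A ** X)) ` elliptic_matrices lam Lam)"
proof (rule bdd_aboveI2)
  fix A :: "real ^ 'n ^ 'n" assume A: "A \<in> elliptic_matrices lam Lam"
  have "- trace (A ** X) = (\<Sum>i\<in>UNIV. \<Sum>k\<in>UNIV. - (A $ i $ k * X $ k $ i))"
    by (simp add: trace_def matrix_matrix_mult_def sum_negf)
  also have "\<dots> \<le> (\<Sum>i\<in>UNIV. \<Sum>k\<in>UNIV. Lam * \<bar>X $ k $ i\<bar>)"
  proof (intro sum_mono)
    fix i k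
    have "- (A $ i $ k * X $ k $ i) \<le> \<bar>A $ i $ k\<bar> * \<bar>X $ k $ i\<bar>"
      by (simp flip: abs_mult)
    also have "\<dots> \<le> Lam * \<bar>X $ k $ i\<bar>"
      using elliptic_matrices_entry_bound[OF A assms] by (intro mult_right_mono) auto
    finally show "- (A $ i $ k * X $ k $ i) \<le> Lam * \<bar>X $ k $ i\<bar>" .
  qed
  finally show "- trace (A ** X) \<le> (\<Sum>i\<in>UNIV. \<Sum>k\<in>UNIV. Lam * \<bar>X $ k $ i\<bar>)" .
qed

lemma elliptic_matrices_nonempty:
  assumes "lam \<le> Lam"
  shows "(mat lam :: real ^ 'n ^ 'n) \<in> elliptic_matrices lam Lam"
  using assms by (simp add: elliptic_matrices_def mat_le_def mat_vector_mult mult_right_mono transpose_mat)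

lemma real_INF_uminus_mult:
  fixes g :: "'a \<Rightarrow> real"
  assumes "S \<noteq> {}" "bdd_above (g ` S)" "0 < k"
  shows "(INF a\<in>S. - (k * g a)) = - (k * (SUP a\<in>S. g a))"
proof -
  have "(SUP a\<in>S. k * g a) = k * (SUP a\<in>S. g a)"
  proof (rule cSup_eq_non_empty)
    show "x \<le> k * (SUP a\<in>S. g a)" if "x \<in> (\<lambda>a. k * g a) ` S" for x
      using that assms by (auto intro!: mult_left_mono cSUP_upper)
    fix y assume y: "\<And>x. x \<in> (\<lambda>a. k * g a) ` S \<Longrightarrow> x \<le> y"
    then have "(SUP a\<in>S. g a) \<le> y / k"
      using assms by (intro cSUP_least) (auto simp: field_simps)
    then show "k * (SUP a\<in>S. g a) \<le> y"
      using assms(3) by (simp add: field_simps)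
  qed (use assms in auto)
  then show ?thesis
    by (simp add: Inf_real_def image_image)
qed

lemma pucci_minus_negative_multiple:
  assumes "0 < lam" "lam \<le> Lam" "0 < k"
  shows "pucci_minus lam Lam (- k *\<^sub>R X) = - (k * pucci_plus lam Lam X)"
proof -
  have "- trace (A ** (- k *\<^sub>R X)) = - (k * - trace (A ** X))" for A
    by (simp add: trace_def matrix_matrix_mult_def sum_distrib_left mult.left_commute sum_negf)
  then show ?thesis
    unfolding pucci_minus_def pucci_plus_def
    using real_INF_uminus_mult[OF _ bdd_above_trace[OF assms(1)] assms(3)]
      elliptic_matrices_nonempty[OF assms(2)] by auto
qed

section \<open>Rescaled data\<close>

lemma Lp_nonneg_pscale:
  fixes g :: "(real ^ 'n) \<times> real \<Rightarrow> real"
  assumes g: "g \<in> Lp_nonneg q Q" and Q: "Q \<in> sets lebesgue" "Q' \<in> sets lebesgue"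
    and P: "pscale r a ` Q' \<subseteq> Q" and r: "0 < r" and q: "0 < q"
    and k: "0 \<le> k" "k \<le> r powr ((real CARD('n) + 2) / q)"
  shows "(\<lambda>z. k * g (pscale r a z)) \<in> Lp_nonneg q Q'"
    and "Lp_norm q Q' (\<lambda>z. k * g (pscale r a z)) \<le> Lp_norm q Q g"
proof -
  interpret nonsingular_diag "pweight r" a
    using r by (intro nonsingular_pweight) simp
  define h where "h z = indicat_real Q z * g z" for z
  have h: "h \<in> Lp q UNIV"
    using g Lp_iff_indicator[OF Q(1), of g q] unfolding h_def Lp_nonneg_def by blast
  have hP: "h (pscale r a z) = g (pscale r a z)" if "z \<in> Q'" for z
    using that P by (auto simp: h_def)
  have "(\<lambda>z. k * h (pscale r a z)) \<in> Lp q UNIV"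
    unfolding pscale_eq using h q by (intro Lp_cmult Lp_diag_affine nonsingular_pweight) (use r in auto)
  then have L: "(\<lambda>z. k * h (pscale r a z)) \<in> Lp q Q'"
    using Lp_mono[OF _ Q(2) less_imp_le[OF q]] by blast
  moreover have "(\<lambda>z. indicat_real Q' z * (k * h (pscale r a z))) =
      (\<lambda>z. indicat_real Q' z * (k * g (pscale r a z)))"
    using hP by (auto simp: fun_eq_iff indicator_def)
  ultimately have L': "(\<lambda>z. k * g (pscale r a z)) \<in> Lp q Q'"
    by (simp only: Lp_iff_indicator[OF Q(2)])
  have "AE z in lebesgue. z \<in> Q \<longrightarrow> 0 \<le> g z"
    using g Q(1) by (simp add: Lp_nonneg_def AE_restrict_space_iff)
  then have "AE z in lebesgue. pscale r a z \<in> Q \<longrightarrow> 0 \<le> g (pscale r a z)"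
    unfolding pscale_eq by (subst AE_comp_iff)
  then have "AE z in lebesgue. z \<in> Q' \<longrightarrow> 0 \<le> k * g (pscale r a z)"
    by eventually_elim (use P k(1) in auto)
  with L' Q(2) show "(\<lambda>z. k * g (pscale r a z)) \<in> Lp_nonneg q Q'"
    by (simp add: Lp_nonneg_def AE_restrict_space_iff)
  let ?N = "CARD('n) + 2"
  have ih: "integrable lebesgue (\<lambda>z. \<bar>h z\<bar> powr q)"
    and mh: "(\<lambda>z. \<bar>h z\<bar> powr q) \<in> borel_measurable lebesgue"
    using h by (auto simp: Lp_UNIV_iff)
  have kq: "k powr q \<le> r ^ ?N"
  proof -
    have "k powr q \<le> (r powr ((real CARD('n) + 2) / q)) powr q"
      using k q by (intro powr_mono2) auto
    also have "\<dots> = r powr (real ?N)"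
      using q by (simp add: powr_powr add.commute)
    also have "\<dots> = r ^ ?N"
      using r by (simp only: powr_realpow)
    finally show ?thesis .
  qed
  have "(\<integral>z. \<bar>k * g (pscale r a z)\<bar> powr q \<partial>lebesgue_on Q') =
      (\<integral>z. indicat_real Q' z * \<bar>k * g (pscale r a z)\<bar> powr q \<partial>lebesgue)"
    by (rule integral_lebesgue_on[OF Q(2)])
  also have "\<dots> \<le> (\<integral>z. k powr q * \<bar>h (pscale r a z)\<bar> powr q \<partial>lebesgue)"
  proof (rule integral_mono')
    show "integrable lebesgue (\<lambda>z. k powr q * \<bar>h (pscale r a z)\<bar> powr q)"
      using ih integrable_comp_iff[of "\<lambda>z. \<bar>h z\<bar> powr q"] by (simp add: pscale_eq)
    show "indicat_real Q' z * \<bar>k * g (pscale r a z)\<bar> powr q \<le> k powr q * \<bar>h (pscale r a z)\<bar> powr q" for z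
      using hP[of z] k(1) by (cases "z \<in> Q'") (auto simp: abs_mult powr_mult)
  qed simp
  also have "\<dots> = k powr q * (\<integral>z. \<bar>h (pscale r a z)\<bar> powr q \<partial>lebesgue)"
    by (rule integral_mult_right_zero)
  also have "\<dots> \<le> r ^ ?N * (\<integral>z. \<bar>h (pscale r a z)\<bar> powr q \<partial>lebesgue)"
    using kq by (intro mult_right_mono integral_nonneg_AE) auto
  also have "\<dots> = (\<integral>z. \<bar>h z\<bar> powr q \<partial>lebesgue)"
    using integral_comp[OF mh] pweight_jacobian[OF r, where 'n = 'n] by (simp add: pscale_eq)
  also have "(\<lambda>z. \<bar>h z\<bar> powr q) = (\<lambda>z. indicat_real Q z * \<bar>g z\<bar> powr q)"
    by (auto simp: h_def fun_eq_iff indicator_def)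
  also have "(\<integral>z. indicat_real Q z * \<bar>g z\<bar> powr q \<partial>lebesgue) = (\<integral>z. \<bar>g z\<bar> powr q \<partial>lebesgue_on Q)"
    by (rule integral_lebesgue_on[OF Q(1), symmetric])
  finally show "Lp_norm q Q' (\<lambda>z. k * g (pscale r a z)) \<le> Lp_norm q Q g"
    unfolding Lp_norm_def using q by (intro powr_mono2 integral_nonneg_AE) auto
qed

section \<open>The growth step\<close>

lemma closure_J3: "closure J3 \<subseteq> {z :: (real ^ 'n) \<times> real. (\<forall>i. \<bar>fst z $ i\<bar> \<le> 1 / 2) \<and> 1 / 4 \<le> snd z \<and> snd z \<le> 1 / 2}"
  (is "_ \<subseteq> ?S")
proof (rule closure_minimal)
  show "J3 \<subseteq> ?S"
  proof
    fix z :: "(real ^ 'n) \<times> real" assume z: "z \<in> J3"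
    have "\<bar>fst z $ i\<bar> \<le> 1 / 2" for i
    proof -
      have "- (1 / 2) < fst z $ i \<and> fst z $ i < 1 / 2"
        using z unfolding J3_def cube_def by (simp add: mem_Times_iff)
      then show ?thesis by linarith
    qed
    with z show "z \<in> ?S" by (simp add: J3_def mem_Times_iff)
  qed
  have "?S = (\<Inter>i. {z. \<bar>fst z $ i\<bar> \<le> 1 / 2}) \<inter> ({z. 1 / 4 \<le> snd z} \<inter> {z. snd z \<le> 1 / 2})"
    by auto
  then show "closed ?S"
    by (auto intro!: closed_INT closed_Int closed_Collect_le continuous_intros)
qed

lemma J1_lmeasurable: "J1 \<in> lmeasurable"
proof (rule bounded_set_imp_lmeasurable)
  have "cube 1 \<subseteq> (cbox (\<chi> i. -1) (\<chi> i. 1) :: (real ^ 'a) set)"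
    by (auto simp: cube_def mem_box_cart less_imp_le)
  then have "bounded (cube 1 :: (real ^ 'a) set)"
    by (rule bounded_subset[OF bounded_cbox])
  then show "bounded (J1 :: ((real ^ 'a) \<times> real) set)"
    unfolding J1_def by (intro bounded_Times) auto
  show "J1 \<in> sets lebesgue"
    unfolding J1_def by (intro lebesgue_sets_cylinder open_cube)
qed

lemma measure_J1_pos: "0 < measure lebesgue (J1 :: ((real ^ 'n) \<times> real) set)"
proof -
  have "open (cube 1 \<times> {0<..<1/2} :: ((real ^ 'n) \<times> real) set)"
    by (intro open_Times open_cube) auto
  moreover have "(0, 1 / 4) \<in> (cube 1 \<times> {0<..<1/2} :: ((real ^ 'n) \<times> real) set)"
    by (simp add: cube_def)
  ultimately have "\<not> negligible (cube 1 \<times> {0<..<1/2} :: ((real ^ 'n) \<times> real) set)"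
    using open_not_negligible by blast
  then have "\<not> negligible (J1 :: ((real ^ 'n) \<times> real) set)"
    by (rule contrapos_nn) (rule negligible_subset, auto simp: J1_def)
  then have "measure lebesgue (J1 :: ((real ^ 'n) \<times> real) set) \<noteq> 0"
    using negligible_iff_measure0[OF J1_lmeasurable] by blast
  then show ?thesis
    by (simp add: zero_less_measure_iff)
qed

lemma superlevel_lmeasurable:
  fixes w :: "'a::euclidean_space \<Rightarrow> real"
  assumes "continuous_on S w" "S \<in> lmeasurable"
  shows "{z \<in> S. s \<le> w z} \<in> lmeasurable"
proof -
  have "closedin (top_of_set S) (S \<inter> w -` {s..})"
    using assms(1) by (intro continuous_closedin_preimage) auto
  then obtain C where "closed C" "S \<inter> w -` {s..} = S \<inter> C"
    by (auto simp: closedin_closed)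
  moreover have "S \<inter> C \<in> lmeasurable" if "closed C" for C
    using assms(2) that by (intro fmeasurable_Int_fmeasurable) (simp_all add: borel_closed)
  ultimately have "S \<inter> w -` {s..} \<in> lmeasurable"
    by simp
  also have "S \<inter> w -` {s..} = {z \<in> S. s \<le> w z}" by auto
  finally show ?thesis .
qed

lemma growth_step:
  fixes f \<mu> v :: "(real ^ 'n) \<times> real \<Rightarrow> real" and z0 :: "(real ^ 'n) \<times> real"
  assumes ell: "0 < lam" "lam \<le> Lam"
    and pq: "(real CARD('n) + 2) / 2 < p" "real CARD('n) + 2 < q"
    and f: "f \<in> Lp_nonneg p Q10" "Lp_norm p Q10 f \<le> \<epsilon>1"
    and \<mu>: "\<mu> \<in> Lp_nonneg q Q10"
    and wH: "weak_Harnack_constants TYPE('n) lam Lam p q (Lp_norm q Q10 \<mu>) A \<beta> \<epsilon>1"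
    and sub: "Lp_visc_subsol p (\<lambda>z \<xi> X. pucci_minus lam Lam X - \<mu> z * norm \<xi> - f z) (cube 10) 10 v"
    and z0: "z0 \<in> closure J3" "M - c \<le> v z0" and c: "1 \<le> c"
    and r: "0 < r" "20 * r \<le> 1"
    and m1: "A * (M / (2 * c)) powr (- \<beta>) < measure lebesgue (J1 :: ((real ^ 'n) \<times> real) set) / 2"
    and m2: "measure lebesgue {z \<in> J1. M / 2 \<le> v z} \<le>
      r ^ (CARD('n) + 2) * (measure lebesgue (J1 :: ((real ^ 'n) \<times> real) set) / 2)"
    and M: "0 < M"
  shows "\<exists>z \<in> Qhat (10 * r) z0. M \<le> v z"
proof (rule ccontr)
  assume "\<not> ?thesis"
  then have small: "v z < M" if "z \<in> Qhat (10 * r) z0" for z using that by (auto simp: not_le)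
  define a where "a = (fst z0, snd z0 - 10 * r\<^sup>2)"
  let ?P = "pscale r a"
  interpret nonsingular_diag "pweight r" a
    using r by (intro nonsingular_pweight) simp
  have z0': "\<bar>fst z0 $ i\<bar> \<le> 1 / 2" "1 / 4 \<le> snd z0" "snd z0 \<le> 1 / 2" for i
    using z0(1) closure_J3 by blast+
  have r2: "0 < r\<^sup>2" "40 * r\<^sup>2 < 1"
  proof -
    have "r\<^sup>2 \<le> (1 / 20)\<^sup>2" using r by (intro power_mono) auto
    then show "40 * r\<^sup>2 < 1" by (simp add: power2_eq_square)
  qed (use r in auto)
  have snd_P: "snd (?P z) = snd z0 - r\<^sup>2 * (10 - snd z)" for z
    by (simp add: pscale_def a_def algebra_simps)
  have fst_P: "fst (?P z) = fst z0 + r *\<^sub>R fst z" for z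
    by (simp add: pscale_def a_def)
  have time: "snd z0 - 10 * r\<^sup>2 < snd (?P z) \<and> snd (?P z) \<le> snd z0" if "0 < snd z" "snd z \<le> 10" for z
  proof -
    have "r\<^sup>2 * (10 - snd z) < r\<^sup>2 * 10" "0 \<le> r\<^sup>2 * (10 - snd z)"
      using that r2(1) by (intro mult_strict_left_mono mult_nonneg_nonneg; simp)+
    then show ?thesis unfolding snd_P by simp
  qed
  have space: "fst (?P z) \<in> cube (1 / 2 + r * e)" if "fst z \<in> cube e" for z e
  proof -
    have "\<bar>fst z $ i\<bar> < e" for i using that by (auto simp: cube_def abs_less_iff minus_less_iff)
    then have le: "r * \<bar>fst z $ i\<bar> < r * e" for i using r(1) by (rule mult_strict_left_mono)
    have tri: "\<bar>fst (?P z) $ i\<bar> \<le> \<bar>fst z0 $ i\<bar> + r * \<bar>fst z $ i\<bar>" for i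
      using r(1) abs_triangle_ineq[of "fst z0 $ i" "r * fst z $ i"] by (simp add: fst_P abs_mult)
    have "- (1 / 2 + r * e) < fst (?P z) $ i \<and> fst (?P z) $ i < 1 / 2 + r * e" for i
      using z0'(1)[of i] le[of i] tri[of i] by linarith
    then show ?thesis unfolding cube_def by blast
  qed
  have PQhat: "?P z \<in> Qhat (10 * r) z0" if "z \<in> Q10" for z
  proof -
    have "r *\<^sub>R fst z \<in> cube (r * 10)"
      using that r by (auto simp: pcylinder_def cube_scaleR)
    moreover have "- ((10 * r)\<^sup>2 / 10) < snd (?P z) - snd z0" "snd (?P z) - snd z0 \<le> 0"
      using time[of z] that by (auto simp: pcylinder_def power_mult_distrib)
    ultimately show ?thesis
      unfolding Qhat_def
      by (intro CollectI exI[of _ "r *\<^sub>R fst z"] exI[of _ "snd (?P z) - snd z0"])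
        (auto simp: prod_eq_iff fst_P mult.commute)
  qed
  have PQ: "?P ` Q10 \<subseteq> Q10"
  proof
    fix y assume "y \<in> ?P ` Q10"
    then obtain z where z: "y = ?P z" "z \<in> Q10" by blast
    then have "fst y \<in> cube (1 / 2 + r * 10)"
      using space[of z 10] by (auto simp: pcylinder_def)
    then have "fst y \<in> cube 10"
      using cube_mono[of "1 / 2 + r * 10" 10] r(2) by auto
    with z time[of z] z0' r2 show "y \<in> Q10"
      by (auto simp: pcylinder_def mem_Times_iff)
  qed
  have PJ1: "?P z \<in> J1" if "z \<in> J1" for z
  proof -
    have "fst (?P z) \<in> cube (1 / 2 + r * 1)"
      using that space[of z 1] by (auto simp: J1_def)
    then have "fst (?P z) \<in> cube 1"
      using cube_mono[of "1 / 2 + r * 1" 1] r by auto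
    with time[of z] z0' r2 that show ?thesis
      by (auto simp: J1_def mem_Times_iff)
  qed
  have J1Q: "J1 \<subseteq> Q10"
    using cube_mono[of 1 10] by (auto simp: J1_def pcylinder_def)
  have J2Q: "J2 \<subseteq> Q10"
    using cube_mono[of 1 10] by (auto simp: J2_def pcylinder_def)
  have setsQ: "Q10 \<in> sets lebesgue"
    unfolding pcylinder_def by (intro lebesgue_sets_cylinder open_cube)
  have c0: "0 < c" using c by simp
  have p1: "1 \<le> p" "0 < p" "0 < q"
  proof -
    have "1 \<le> (real CARD('n) + 2) / 2" by simp
    with pq show "1 \<le> p" "0 < p" "0 < q" by linarith+
  qed
  have r1: "r \<le> 1" using r by simp
  define w where "w z = (M - v (?P z)) / c" for z
  define \<mu>' where "\<mu>' z = r * \<mu> (?P z)" for z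
  define f' where "f' z = r\<^sup>2 / c * f (?P z)" for z
  have "Lp_visc_supersol p (\<lambda>z \<xi> X. pucci_plus lam Lam X + \<mu>' z * norm \<xi> + f' z) (cube 10) 10 w"
  proof -
    have "- (r\<^sup>2 / c) * (pucci_minus lam Lam (- (c / r\<^sup>2) *\<^sub>R X)
        - \<mu> (?P z) * norm (- (c / r) *\<^sub>R \<xi>) - f (?P z)) =
        pucci_plus lam Lam X + \<mu>' z * norm \<xi> + f' z"
      for z and \<xi> :: "real ^ 'n" and X :: "real ^ 'n ^ 'n"
    proof -
      have "pucci_minus lam Lam (- (c / r\<^sup>2) *\<^sub>R X) = - (c / r\<^sup>2 * pucci_plus lam Lam X)"
        using ell c0 r(1) by (intro pucci_minus_negative_multiple) auto
      moreover have "norm (- (c / r) *\<^sub>R \<xi>) = c / r * norm \<xi>"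
        using c0 r(1) by simp
      ultimately show ?thesis
        using c0 r(1) by (simp add: \<mu>'_def f'_def field_simps power2_eq_square)
    qed
    then show ?thesis
      using Lp_visc_supersol_rescale[OF open_cube p1(1) r(1) c0 sub PQ, of M]
      by (simp only: w_def[abs_def])
  qed
  moreover have "\<mu>' \<in> Lp_nonneg q Q10" "Lp_norm q Q10 \<mu>' \<le> Lp_norm q Q10 \<mu>"
  proof -
    have "r powr 1 \<le> r powr ((real CARD('n) + 2) / q)"
      using r(1) r1 pq p1 by (intro powr_mono') auto
    then have k: "r \<le> r powr ((real CARD('n) + 2) / q)" using r(1) by simp
    show "\<mu>' \<in> Lp_nonneg q Q10" "Lp_norm q Q10 \<mu>' \<le> Lp_norm q Q10 \<mu>"
      unfolding \<mu>'_def using Lp_nonneg_pscale[OF \<mu> setsQ setsQ PQ r(1) p1(3) less_imp_le[OF r(1)] k] .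
  qed
  moreover have "f' \<in> Lp_nonneg p Q10" "Lp_norm p Q10 f' \<le> \<epsilon>1"
  proof -
    have "r\<^sup>2 / c \<le> r\<^sup>2"
      using c r2(1) by (simp add: field_simps mult_left_mono)
    also have "r\<^sup>2 = r powr 2"
      using r(1) by (simp add: powr_numeral)
    also have "\<dots> \<le> r powr ((real CARD('n) + 2) / p)"
      using r(1) r1 pq p1 by (intro powr_mono') (auto simp: field_simps)
    finally have k: "r\<^sup>2 / c \<le> r powr ((real CARD('n) + 2) / p)" .
    have k0: "0 \<le> r\<^sup>2 / c" using c0 by simp
    show "f' \<in> Lp_nonneg p Q10" "Lp_norm p Q10 f' \<le> \<epsilon>1"
      unfolding f'_def using Lp_nonneg_pscale[OF f(1) setsQ setsQ PQ r(1) p1(2) k0 k] f(2) by auto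
  qed
  moreover have w0: "0 \<le> w z" if "z \<in> Q10" for z
    using small[OF PQhat[OF that]] c0 by (simp add: w_def)
  moreover have "(INF z\<in>J2. w z) \<le> 1"
  proof -
    have "(0, 10) \<in> (J2 :: ((real ^ 'n) \<times> real) set)"
      by (simp add: J2_def cube_def)
    then have "(INF z\<in>J2. w z) \<le> w (0, 10)"
      using w0 J2Q by (intro cINF_lower bdd_belowI2[of _ 0]) auto
    also have "?P (0, 10) = z0"
      by (simp add: prod_eq_iff fst_P snd_P)
    then have "w (0, 10) \<le> 1"
      using z0(2) c0 by (simp add: w_def)
    finally show ?thesis .
  qed
  moreover have "0 < M / (2 * c)" using M c0 by simp
  ultimately have G: "measure lebesgue {z \<in> J1. M / (2 * c) \<le> w z} \<le> A * (M / (2 * c)) powr (- \<beta>)"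
    using wH unfolding weak_Harnack_constants_def by blast
  let ?G = "{z \<in> J1. M / (2 * c) \<le> w z}" and ?E = "{z \<in> J1. M / 2 \<le> v (?P z)}"
    and ?F = "{z \<in> J1. M / 2 \<le> v z}"
  have cv: "continuous_on Q10 v"
    using sub by (simp add: Lp_visc_subsol_def)
  have cvP: "continuous_on J1 (\<lambda>z. v (?P z))"
  proof (rule continuous_on_compose2[OF cv])
    show "continuous_on J1 ?P"
      unfolding pscale_def[abs_def] by (intro continuous_intros)
    show "?P ` J1 \<subseteq> Q10" using PQ J1Q by blast
  qed
  have mF: "?F \<in> lmeasurable"
    using cv J1Q J1_lmeasurable by (intro superlevel_lmeasurable) (auto intro: continuous_on_subset)
  have mE: "?E \<in> lmeasurable"
    using cvP J1_lmeasurable by (rule superlevel_lmeasurable)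
  have mG: "?G \<in> lmeasurable"
    unfolding w_def using c0 by (intro superlevel_lmeasurable J1_lmeasurable continuous_intros cvP) auto
  have "measure lebesgue ?E \<le> measure lebesgue (J1 :: ((real ^ 'n) \<times> real) set) / 2"
  proof -
    have PF: "?P -` ?F \<in> sets lebesgue"
      using vimage_sets[OF fmeasurableD[OF mF]] by (simp add: pscale_eq)
    have "emeasure lebesgue (?P -` ?F) < \<infinity>"
      using emeasure_vimage[OF fmeasurableD[OF mF]] mF jacobian_pos
      by (auto simp: pscale_eq fmeasurable_def ennreal_mult_less_top)
    then have "?P -` ?F \<in> lmeasurable"
      using PF by (intro fmeasurableI) auto
    moreover have "?E \<subseteq> ?P -` ?F" using PJ1 by auto
    ultimately have "measure lebesgue ?E \<le> measure lebesgue (?P -` ?F)"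
      using mE by (intro measure_mono_fmeasurable fmeasurableD) auto
    then have "r ^ (CARD('n) + 2) * measure lebesgue ?E \<le> r ^ (CARD('n) + 2) * measure lebesgue (?P -` ?F)"
      using r(1) by (intro mult_left_mono) auto
    also have "\<dots> = measure lebesgue ?F"
      using measure_vimage[OF fmeasurableD[OF mF]] pweight_jacobian[OF r(1), where 'n = 'n]
      by (simp add: pscale_eq)
    also note m2
    finally show ?thesis
      using r(1) by (simp only: mult_le_cancel_left_pos zero_less_power)
  qed
  moreover have "measure lebesgue (J1 :: ((real ^ 'n) \<times> real) set) \<le> measure lebesgue ?G + measure lebesgue ?E"
  proof -
    have "J1 \<subseteq> ?G \<union> ?E"
    proof
      fix z :: "(real ^ 'n) \<times> real" assume z: "z \<in> J1"
      have "M / (2 * c) \<le> w z" if "v (?P z) < M / 2"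
      proof -
        have "M / (2 * c) = (M / 2) / c" by simp
        also have "\<dots> \<le> (M - v (?P z)) / c"
          using that c0 by (intro divide_right_mono) auto
        finally show ?thesis by (simp add: w_def)
      qed
      with z show "z \<in> ?G \<union> ?E" by auto
    qed
    then have "measure lebesgue (J1 :: ((real ^ 'n) \<times> real) set) \<le> measure lebesgue (?G \<union> ?E)"
      using mG mE J1_lmeasurable
      by (intro measure_mono_fmeasurable fmeasurableD fmeasurable.Un) auto
    also have "\<dots> \<le> measure lebesgue ?G + measure lebesgue ?E"
      using mG mE by (intro measure_Un_le fmeasurableD)
    finally show ?thesis .
  qed
  ultimately show False
    using G m1 by linarith
qed

theorem lemma4p3:
  fixes lam Lam p q p1 A0 \<beta>0 Astar \<beta>star :: real
  assumes "0 < lam" "lam \<le> Lam"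
    and "ABP_exponent TYPE('n::finite) lam Lam p1"
    and "real CARD('n) + 2 < q" "p1 < p" "p \<le> q"
    and "\<beta>0 > 0" "A0 > 1"
  shows "\<exists>(\<nu>::real) (n0::nat) (l :: nat \<Rightarrow> real).
     \<nu> > 1 \<and> n0 \<ge> 1 \<and> (\<forall>j\<ge>1. 0 < l j \<and> l j < 1) \<and> summable (\<lambda>j. l (Suc j)) \<and>
     (\<forall>(f :: (real ^ 'n) \<times> real \<Rightarrow> real) \<mu> v \<epsilon>1.
        f \<in> Lp_nonneg p Q10 \<longrightarrow> \<mu> \<in> Lp_nonneg q Q10 \<longrightarrow>
        weak_Harnack_constants TYPE('n) lam Lam p q (Lp_norm q Q10 \<mu>) Astar \<beta>star \<epsilon>1 \<longrightarrow>
        Lp_norm p Q10 f \<le> \<epsilon>1 \<longrightarrow>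
        Lp_visc_subsol p (\<lambda>z \<xi> X. pucci_minus lam Lam X - \<mu> z * norm \<xi> - f z) (cube 10) 10 v \<longrightarrow>
        (\<forall>s\<ge>1. measure lebesgue {z \<in> J1. v z \<ge> s} \<le> A0 * s powr (- \<beta>0)) \<longrightarrow>
        (\<forall>j\<ge>n0. \<forall>z0 \<in> closure J3. v z0 \<ge> \<nu> ^ (j - 1) \<longrightarrow>
           (SUP z \<in> Qhat (l j) z0. ereal (v z)) \<ge> ereal (\<nu> ^ j)))"
proof -
  define K where "K = measure lebesgue (J1 :: ((real ^ 'n) \<times> real) set)"
  have K: "0 < K" unfolding K_def by (rule measure_J1_pos)
  define N where "N = CARD('n) + 2"
  have N: "0 < N" by (simp add: N_def)
  have p: "(real CARD('n) + 2) / 2 < p"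
    using assms(3,5) by (simp add: ABP_exponent_def)
  define b where "b = (if 0 < \<beta>star then \<beta>star else 1)"
  have b: "0 < b" by (simp add: b_def)
  obtain s0 where s0: "1 \<le> s0" "max Astar 1 * s0 powr (- b) < K / 2"
  proof -
    have "((\<lambda>s. max Astar 1 * s powr (- b)) \<longlongrightarrow> max Astar 1 * 0) at_top"
      using b by (intro tendsto_mult_left tendsto_neg_powr filterlim_ident) auto
    then have "eventually (\<lambda>s. max Astar 1 * s powr (- b) < K / 2) at_top"
      using K by (intro order_tendstoD(2)) auto
    then have "eventually (\<lambda>s. 1 \<le> s \<and> max Astar 1 * s powr (- b) < K / 2) at_top"
      using eventually_ge_at_top[of 1] by eventually_elim auto
    then show thesis
      using that by (auto simp: eventually_at_top_linorder)
  qed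
  \<comment> \<open>chosen so that \<open>\<nu> ^ j / (2 * c) = s0\<close> for the \<open>c\<close> used in the growth step\<close>
  define \<nu> where "\<nu> = 2 * s0 / (2 * s0 - 1)"
  have \<nu>: "1 < \<nu>" using s0(1) by (simp add: \<nu>_def field_simps)
  have \<nu>s0: "\<nu> = 2 * s0 * (\<nu> - 1)" using s0(1) by (simp add: \<nu>_def field_simps)
  define B where "B = (2 * A0 * 2 powr \<beta>0 / K) powr (1 / real N)"
  define \<theta> where "\<theta> = \<nu> powr (- \<beta>0 / real N)"
  have B: "0 < B" using assms(8) K by (simp add: B_def)
  have \<theta>: "0 < \<theta>" "\<theta> < 1"
    using \<nu> assms(7) N by (simp_all add: \<theta>_def powr_less_one divide_neg_pos)
  have BN: "B ^ N = 2 * A0 * 2 powr \<beta>0 / K"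
    using assms(8) K N by (simp add: B_def powr_powr flip: powr_realpow)
  have \<theta>N: "(\<theta> ^ j) ^ N = (\<nu> ^ j) powr (- \<beta>0)" for j
    using \<nu> N by (simp add: \<theta>_def powr_powr powr_mult mult.commute flip: powr_realpow power_mult)
  define l where "l j = min (1 / 2) (10 * (B * \<theta> ^ j))" for j
  have l: "0 < l j" "l j < 1" for j
    using B \<theta> by (simp_all add: l_def)
  have "summable (\<lambda>j. 10 * (B * \<theta>) * \<theta> ^ j)"
    using \<theta> by (intro summable_mult summable_geometric) auto
  then have suml: "summable (\<lambda>j. l (Suc j))"
    by (rule summable_comparison_test'[where N = 0])
      (use B \<theta> in \<open>simp add: l_def mult_ac\<close>)
  have "eventually (\<lambda>j. 10 * (B * \<theta> ^ j) < 1 / 2) sequentially"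
    using tendsto_mult_left[OF LIMSEQ_realpow_zero[OF less_imp_le[OF \<theta>(1)] \<theta>(2)], of "10 * B"]
    by (intro order_tendstoD(2)[of _ 0]) (simp_all add: mult.assoc)
  moreover have "eventually (\<lambda>j. max 2 (\<nu> / (\<nu> - 1)) \<le> \<nu> ^ j) sequentially"
  proof -
    obtain m where m: "max 2 (\<nu> / (\<nu> - 1)) < \<nu> ^ m"
      using real_arch_pow[OF \<nu>] by blast
    have "\<nu> ^ m \<le> \<nu> ^ j" if "m \<le> j" for j
      using that \<nu> by (intro power_increasing) auto
    with m show ?thesis
      by (intro eventually_sequentiallyI[of m]) (meson less_imp_le order_trans)
  qed
  ultimately have "eventually (\<lambda>j. 10 * (B * \<theta> ^ j) < 1 / 2 \<and> max 2 (\<nu> / (\<nu> - 1)) \<le> \<nu> ^ j) sequentially"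
    by eventually_elim auto
  then obtain n1 where n1: "\<And>j. n1 \<le> j \<Longrightarrow> 10 * (B * \<theta> ^ j) < 1 / 2 \<and> max 2 (\<nu> / (\<nu> - 1)) \<le> \<nu> ^ j"
    by (auto simp: eventually_sequentially)
  have step: "(SUP z \<in> Qhat (l j) z0. ereal (v z)) \<ge> ereal (\<nu> ^ j)"
    if f: "f \<in> Lp_nonneg p Q10" and \<mu>: "\<mu> \<in> Lp_nonneg q Q10"
      and wH: "weak_Harnack_constants TYPE('n) lam Lam p q (Lp_norm q Q10 \<mu>) Astar \<beta>star \<epsilon>1"
      and f1: "Lp_norm p Q10 f \<le> \<epsilon>1"
      and sub: "Lp_visc_subsol p (\<lambda>z \<xi> X. pucci_minus lam Lam X - \<mu> z * norm \<xi> - f z) (cube 10) 10 v"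
      and decay: "\<forall>s\<ge>1. measure lebesgue {z \<in> J1. v z \<ge> s} \<le> A0 * s powr (- \<beta>0)"
      and j: "max 1 n1 \<le> j" and z0: "z0 \<in> closure J3" "\<nu> ^ (j - 1) \<le> v z0"
    for f \<mu> v :: "(real ^ 'n) \<times> real \<Rightarrow> real" and \<epsilon>1 j z0
  proof -
    define c where "c = \<nu> ^ (j - 1) * (\<nu> - 1)"
    define r where "r = B * \<theta> ^ j"
    have r: "0 < r" "20 * r \<le> 1" and big: "2 \<le> \<nu> ^ j" "\<nu> / (\<nu> - 1) \<le> \<nu> ^ j"
      using n1[of j] j B \<theta> by (auto simp: r_def)
    have lj: "l j = 10 * r"
      using r by (simp add: l_def r_def)
    have \<nu>j: "\<nu> ^ j = \<nu> * \<nu> ^ (j - 1)"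
      using j by (cases j) auto
    have c1: "1 \<le> c"
    proof -
      have "\<nu> * (1 / (\<nu> - 1)) \<le> \<nu> * \<nu> ^ (j - 1)"
        using big(2) unfolding \<nu>j by simp
      moreover have "0 < \<nu>" using \<nu> by simp
      ultimately have "1 / (\<nu> - 1) \<le> \<nu> ^ (j - 1)"
        by (simp only: mult_le_cancel_left_pos)
      with \<nu> show ?thesis by (simp add: c_def pos_divide_le_eq)
    qed
    have Mc: "\<nu> ^ j - c = \<nu> ^ (j - 1)"
      unfolding \<nu>j c_def by (simp add: algebra_simps)
    have Mc2: "\<nu> ^ j / (2 * c) = s0"
    proof -
      have "\<nu> ^ j = 2 * s0 * (\<nu> - 1) * \<nu> ^ (j - 1)"
        unfolding \<nu>j using \<nu>s0 by simp
      also have "\<dots> = s0 * (2 * c)" by (simp add: c_def)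
      finally show ?thesis using c1 by simp
    qed
    have pos: "0 < Astar" "0 < \<beta>star"
      using wH by (simp_all add: weak_Harnack_constants_def)
    have m1: "Astar * (\<nu> ^ j / (2 * c)) powr (- \<beta>star) < measure lebesgue (J1 :: ((real ^ 'n) \<times> real) set) / 2"
    proof -
      have "Astar * s0 powr (- \<beta>star) \<le> max Astar 1 * s0 powr (- b)"
        using pos by (simp add: b_def mult_right_mono)
      with s0(2) show ?thesis unfolding Mc2 K_def by linarith
    qed
    have "measure lebesgue {z \<in> J1. \<nu> ^ j / 2 \<le> v z} \<le> A0 * (\<nu> ^ j / 2) powr (- \<beta>0)"
      by (rule decay[rule_format]) (use big(1) in simp)
    also have "\<dots> = A0 * 2 powr \<beta>0 * (\<nu> ^ j) powr (- \<beta>0)"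
      using \<nu> by (simp add: powr_divide powr_minus field_simps)
    also have "\<dots> = B ^ N * (\<theta> ^ j) ^ N * (K / 2)"
      unfolding BN \<theta>N using K by simp
    also have "\<dots> = r ^ (CARD('n) + 2) * (measure lebesgue (J1 :: ((real ^ 'n) \<times> real) set) / 2)"
      by (simp only: r_def power_mult_distrib N_def K_def)
    finally have m2: "measure lebesgue {z \<in> J1. \<nu> ^ j / 2 \<le> v z} \<le>
        r ^ (CARD('n) + 2) * (measure lebesgue (J1 :: ((real ^ 'n) \<times> real) set) / 2)" .
    have "0 < \<nu> ^ j" "\<nu> ^ j - c \<le> v z0"
      using \<nu> z0(2) Mc by simp_all
    then obtain z where "z \<in> Qhat (10 * r) z0" "\<nu> ^ j \<le> v z"
      using growth_step[OF assms(1,2) p assms(4) f f1 \<mu> wH sub z0(1) _ c1 r m1 m2] by blast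
    then show ?thesis
      unfolding lj by (intro SUP_upper2) auto
  qed
  show ?thesis
    by (rule exI[of _ \<nu>], rule exI[of _ "max 1 n1"], rule exI[of _ l])
      (use \<nu> l suml step in auto)
qed

end
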